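(* Assume the continuum hypothesis ($2^{\aleph_0}=\aleph_1$). Then there is a group $G$ with the following properties: (a) $S\subseteq G\subseteq D$ and $G$ is pure in $D$ (hence also in $P$). (b) $\operatorname{End} G=\mathbb{Z}\oplus\operatorname{Fin} G$, i.e., every endomorphism of $G$ is almost scalar. (c) The dual group $G^*=\operatorname{Hom}(G,\mathbb{Z})$ is uncountable.
   Context: All groups are abelian. $P=\mathbb{Z}^{\aleph_0}=\prod_{i\in\omega}e_i\mathbb{Z}$ is the Baer-Specker group, the additive group of all integer-valued sequences, and $S=\mathbb{Z}^{(\aleph_0)}=\bigoplus_{i\in\omega}e_i\mathbb{Z}\subseteq P$ is the subgroup of sequences of finite support. $D$ is the $\mathbb{Z}$-adic closure of $S$ in $P$, i.e., the pre-image under the quotient map $P\to P/S$ of the maximal divisible subgroup of $P/S$; thus $S\subseteq D\subseteq P$ and $D/S$ is the maximal divisible subgroup of $P/S$. A subgroup $H$ of a group $K$ is pure in $K$ if $H\cap nK=nH$ for every integer $n$. $\operatorname{End}G$ is the endomorphism ring of $G$, and $\operatorname{Fin}G$ is the two-sided ideal of $\operatorname{End}G$ consisting of the endomorphisms whose image has finite rank. For $z\in\mathbb{Z}$, the endomorphism of $G$ given by multiplication by $z$ is also denoted $z$ and is called scalar; $\mathbb{Z}$ also denotes the set of scalar endomorphisms of $G$. An endomorphism of $G$ is almost scalar if it differs from a scalar endomorphism by an endomorphism whose image has finite rank. The direct sum in (b) is a direct sum of additive groups. *)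

theory Defs
  imports "HOL-Algebra.Product_Groups" "HOL-Algebra.AbelCoset" "HOL-Library.Countable_Set"
begin

unbundle cardinal_syntax

text \<open>Abelian groups are the (multiplicatively written) groups of HOL-Algebra, so \<open>x [^] n\<close>
  stands for the multiple \<open>n x\<close>. A subgroup \<open>H\<close> of \<open>K\<close> is a set; viewed as a group it is
  \<open>K\<lparr>carrier := H\<rparr>\<close>.\<close>

definition continuum_hypothesis :: bool where
  "continuum_hypothesis \<longleftrightarrow> ctwo ^c natLeq =o cardSuc natLeq"


subsection \<open>Pure and divisible subgroups\<close>

definition multiples :: "('a, 'b) monoid_scheme \<Rightarrow> int \<Rightarrow> 'a set \<Rightarrow> 'a set" where
  "multiples K n H = (\<lambda>x. x [^]\<^bsub>K\<^esub> n) ` H"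

definition pure_subgroup :: "'a set \<Rightarrow> ('a, 'b) monoid_scheme \<Rightarrow> bool" where
  "pure_subgroup H K \<longleftrightarrow>
     subgroup H K \<and> (\<forall>n. H \<inter> multiples K n (carrier K) = multiples K n H)"

definition divisible_subgroup :: "'a set \<Rightarrow> ('a, 'b) monoid_scheme \<Rightarrow> bool" where
  "divisible_subgroup H K \<longleftrightarrow> subgroup H K \<and> (\<forall>n. n \<noteq> 0 \<longrightarrow> multiples K n H = H)"

text \<open>The sum of all divisible subgroups; see \<open>divisible_part_greatest\<close> below.\<close>

definition divisible_part :: "('a, 'b) monoid_scheme \<Rightarrow> 'a set" where
  "divisible_part K = generate K (\<Union>{H. divisible_subgroup H K})"


subsection \<open>The groups \<open>S \<subseteq> D \<subseteq> P\<close>, with \<open>P\<close> the Baer--Specker group\<close>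

definition bs_P :: "(nat \<Rightarrow> int) monoid" where
  "bs_P = product_group UNIV (\<lambda>_. integer_group)"

definition bs_S :: "(nat \<Rightarrow> int) set" where
  "bs_S = carrier (sum_group UNIV (\<lambda>_. integer_group))"

definition bs_D :: "(nat \<Rightarrow> int) set" where
  "bs_D = {x \<in> carrier bs_P. bs_S #>\<^bsub>bs_P\<^esub> x \<in> divisible_part (bs_P Mod bs_S)}"


subsection \<open>Rank\<close>

text \<open>Linear independence over the integers. This gives the torsion-free rank, which is the rank
  for the torsion-free groups considered here.\<close>

definition int_independent :: "('a, 'b) monoid_scheme \<Rightarrow> 'a set \<Rightarrow> bool" where
  "int_independent K X \<longleftrightarrow> X \<subseteq> carrier K \<and>
     (\<forall>F (c :: 'a \<Rightarrow> int). finite F \<and> F \<subseteq> X \<and> finprod K (\<lambda>x. x [^]\<^bsub>K\<^esub> c x) F = \<one>\<^bsub>K\<^esub>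
        \<longrightarrow> (\<forall>x\<in>F. c x = 0))"

definition finite_rank :: "('a, 'b) monoid_scheme \<Rightarrow> bool" where
  "finite_rank K \<longleftrightarrow>
     (\<exists>X. finite X \<and> int_independent K X \<and> (\<forall>Y. int_independent K Y \<and> X \<subseteq> Y \<longrightarrow> Y = X))"


subsection \<open>Endomorphisms and the dual group\<close>

text \<open>Homomorphisms out of \<open>G\<close> are taken to be \<open>undefined\<close> outside \<open>carrier G\<close>, so that each of
  them is represented by exactly one HOL function.\<close>

definition End :: "('a, 'b) monoid_scheme \<Rightarrow> ('a \<Rightarrow> 'a) ring" where
  "End G = \<lparr>carrier = hom G G \<inter> extensional (carrier G),
     monoid.mult = compose (carrier G),
     one = (\<lambda>x\<in>carrier G. x),
     zero = (\<lambda>x\<in>carrier G. \<one>\<^bsub>G\<^esub>),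
     add = (\<lambda>f g. \<lambda>x\<in>carrier G. f x \<otimes>\<^bsub>G\<^esub> g x)\<rparr>"

definition Fin :: "('a, 'b) monoid_scheme \<Rightarrow> ('a \<Rightarrow> 'a) set" where
  "Fin G = {f \<in> carrier (End G). finite_rank (G\<lparr>carrier := f ` carrier G\<rparr>)}"

definition Scalar :: "('a, 'b) monoid_scheme \<Rightarrow> ('a \<Rightarrow> 'a) set" where
  "Scalar G = range (\<lambda>z::int. \<lambda>x\<in>carrier G. x [^]\<^bsub>G\<^esub> z)"

definition internal_direct_sum :: "('a, 'b) ring_scheme \<Rightarrow> 'a set \<Rightarrow> 'a set \<Rightarrow> bool" where
  "internal_direct_sum R A B \<longleftrightarrow>
     subgroup A (add_monoid R) \<and> subgroup B (add_monoid R) \<and>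
     carrier R = A <+>\<^bsub>R\<^esub> B \<and> A \<inter> B = {\<zero>\<^bsub>R\<^esub>}"

definition dual_group :: "('a, 'b) monoid_scheme \<Rightarrow> ('a \<Rightarrow> int) monoid" where
  "dual_group G = \<lparr>carrier = hom G integer_group \<inter> extensional (carrier G),
     monoid.mult = (\<lambda>f g. \<lambda>x\<in>carrier G. f x + g x),
     one = (\<lambda>x\<in>carrier G. 0)\<rparr>"


subsection \<open>Sanity checks\<close>

lemma divisible_subgroupI:
  assumes "comm_group K" "subgroup H K"
    and "\<And>n x. \<lbrakk>n \<noteq> (0::int); x \<in> H\<rbrakk> \<Longrightarrow> \<exists>y\<in>H. x = y [^]\<^bsub>K\<^esub> n"
  shows "divisible_subgroup H K"
proof -
  interpret comm_group K by fact
  have "y [^]\<^bsub>K\<^esub> (n::int) \<in> H" if "y \<in> H" for y n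
    using assms(2) that by (rule subgroup_int_pow_closed)
  with assms(3) have "multiples K n H = H" if "n \<noteq> 0" for n
    using that unfolding multiples_def by blast
  with assms(2) show ?thesis by (simp add: divisible_subgroup_def)
qed

lemma divisible_part_greatest:
  fixes K (structure)
  assumes "comm_group K"
  shows "divisible_subgroup (divisible_part K) K"
    and "divisible_subgroup H K \<Longrightarrow> H \<subseteq> divisible_part K"
proof -
  interpret comm_group K by fact
  let ?U = "\<Union>{H. divisible_subgroup H K}"
  have sub: "?U \<subseteq> carrier K"
    by (auto simp: divisible_subgroup_def dest: subgroup.mem_carrier)
  have U_div: "\<exists>y \<in> ?U. x = y [^] n" if "x \<in> ?U" "n \<noteq> 0" for x and n :: int
  proof -
    from that obtain H where H: "divisible_subgroup H K" "x \<in> H" by auto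
    then have "x \<in> multiples K n H" using that(2) by (simp add: divisible_subgroup_def)
    then show ?thesis using H(1) by (auto simp: multiples_def)
  qed
  have "\<exists>y \<in> generate K ?U. x = y [^] n" if x: "x \<in> generate K ?U" and n: "n \<noteq> 0" for x and n :: int
    using x
  proof induction
    case one
    then show ?case by (intro bexI[of _ \<one>]) (auto intro: generate.one)
  next
    case (incl h)
    then show ?case using U_div[OF _ n] by (meson generate.incl)
  next
    case (inv h)
    then obtain y where y: "y \<in> ?U" "h = y [^] n" using U_div[OF _ n] by blast
    then have "y \<in> carrier K" using sub by blast
    then have "inv h = (inv y) [^] n" using y(2) by (simp add: int_pow_inv)
    then show ?case using y(1) by (meson generate.inv)
  next
    case (eng h1 h2)
    then obtain y1 y2 where y: "y1 \<in> generate K ?U" "h1 = y1 [^] n"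
      "y2 \<in> generate K ?U" "h2 = y2 [^] n" by blast
    then have "y1 \<in> carrier K" "y2 \<in> carrier K"
      using generate_in_carrier[OF sub] by auto
    then have "h1 \<otimes> h2 = (y1 \<otimes> y2) [^] n" using y by (simp add: int_pow_distrib)
    then show ?case using y by (meson generate.eng)
  qed
  then show "divisible_subgroup (divisible_part K) K"
    unfolding divisible_part_def
    by (intro divisible_subgroupI assms generate_is_subgroup sub)
  show "H \<subseteq> divisible_part K" if "divisible_subgroup H K"
    using that unfolding divisible_part_def by (auto intro: generate.incl)
qed

lemma ring_End:
  fixes G (structure)
  assumes "comm_group G"
  shows "ring (End G)"
proof -
  interpret comm_group G by fact
  have hc: "f x \<in> carrier G" if "f \<in> hom G G" "x \<in> carrier G" for f x
    using that by (rule hom_in_carrier)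
  show ?thesis
  proof (rule ringI)
    show "abelian_group (End G)"
    proof (rule abelian_groupI)
      fix f assume f: "f \<in> carrier (End G)"
      have "(\<lambda>x\<in>carrier G. inv f x) \<in> carrier (End G)"
        using f by (auto simp: End_def hom_def Pi_iff inv_mult)
      moreover have "(\<lambda>x\<in>carrier G. inv f x) \<oplus>\<^bsub>End G\<^esub> f = \<zero>\<^bsub>End G\<^esub>"
        using f by (auto simp: End_def hc fun_eq_iff)
      ultimately show "\<exists>g\<in>carrier (End G). g \<oplus>\<^bsub>End G\<^esub> f = \<zero>\<^bsub>End G\<^esub>" by blast
    qed (auto simp: End_def hom_def Pi_iff m_ac fun_eq_iff extensional_def)
    show "monoid (End G)"
      by (rule monoidI)
        (auto simp: End_def hom_def Pi_iff fun_eq_iff extensional_def compose_def)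
  qed (auto simp: End_def hom_def Pi_iff fun_eq_iff extensional_def compose_def)
qed

end

theory Submission
  imports Defs "HOL-Library.Function_Algebras" "HOL-Library.Countable_Set_Type"
begin

text \<open>For \<open>a \<in> P\<close> and \<open>x \<in> D\<close> the sum \<open>\<Sum> a\<^sub>i x\<^sub>i\<close> converges in the \<open>\<int>\<close>-adic completion of the integers; say
  that \<open>a\<close> is integral at \<open>x\<close> if its value is an integer. By transfinite recursion of length \<open>\<omega>\<^sub>1\<close>, choose
  for every additive map \<open>\<Phi> : S \<rightarrow> P\<close> (by the continuum hypothesis there are \<open>\<aleph>\<^sub>1\<close> of them) a pair
  \<open>x\<^sub>\<Phi> \<in> D\<close>, \<open>a\<^sub>\<Phi> \<in> P\<close> so that all \<open>a\<^sub>\<Phi>\<close> are distinct and integral at all \<open>x\<^sub>\<Psi>\<close>, while \<open>a\<^sub>\<Phi>\<close> is not integral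
  at \<open>\<Phi>(x\<^sub>\<Phi>)\<close>, unless some \<open>m\<Phi> + n\<close> with \<open>m \<noteq> 0\<close> vanishes on the joint kernel of finitely many
  of the sequences \<open>a\<^sub>\<Psi>\<close> and coordinate functionals. Only countably many constraints are present at each
  stage, so \<open>x\<^sub>\<Phi>\<close> and \<open>a\<^sub>\<Phi>\<close> can be built as sums of finite blocks.

  Let \<open>G\<close> consist of the \<open>x \<in> D\<close> at which all \<open>a\<^sub>\<Phi>\<close> are integral. It is pure, and the \<open>a\<^sub>\<Phi>\<close> give
  uncountably many homomorphisms to the integers. An endomorphism \<open>f\<close> of \<open>G\<close> maps \<open>x\<^sub>f\<close> into \<open>G\<close>, so it is in the
  exceptional case: \<open>mf + n\<close> factors, up to a nonzero multiple, through finitely many functionals and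
  has finite rank. Evaluating at a primitive element of \<open>S\<close> in the joint kernel gives \<open>m dvd n\<close>, and
  \<open>f\<close> is almost scalar.\<close>

subsection \<open>Finitely supported sequences and integer functionals\<close>

lemma bs_S_iff: "s \<in> bs_S \<longleftrightarrow> (\<exists>N. \<forall>i\<ge>N. s i = 0)"
proof -
  have "s \<in> bs_S \<longleftrightarrow> finite {i. s i \<noteq> 0}"
    by (simp add: bs_S_def carrier_sum_group)
  also have "\<dots> \<longleftrightarrow> (\<exists>N. \<forall>i\<ge>N. s i = 0)"
    unfolding finite_nat_set_iff_bounded using linorder_not_less by blast
  finally show ?thesis .
qed

definition unit_seq :: "nat \<Rightarrow> nat \<Rightarrow> int" where
  "unit_seq k = (\<lambda>i. of_bool (i = k))"

text \<open>Meaningful only for \<open>s \<in> bs_S\<close>: a sum over an infinite set is \<open>0\<close> by convention.\<close>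

definition dot :: "(nat \<Rightarrow> int) \<Rightarrow> (nat \<Rightarrow> int) \<Rightarrow> int" where
  "dot a s = (\<Sum>i | s i \<noteq> 0. a i * s i)"

lemma dot_eq_sum:
  assumes "\<And>i. i \<ge> N \<Longrightarrow> s i = 0"
  shows "dot a s = (\<Sum>i<N. a i * s i)"
proof -
  have "{i. s i \<noteq> 0} \<subseteq> {..<N}" using assms linorder_not_less by blast
  then show ?thesis unfolding dot_def by (intro sum.mono_neutral_left) auto
qed

lemma bs_S_common_bound:
  assumes "s \<in> bs_S" "t \<in> bs_S"
  obtains N where "\<And>i. i \<ge> N \<Longrightarrow> s i = 0" "\<And>i. i \<ge> N \<Longrightarrow> t i = 0"
proof -
  obtain N1 N2 where "\<forall>i\<ge>N1. s i = 0" "\<forall>i\<ge>N2. t i = 0"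
    using assms bs_S_iff by blast
  then show ?thesis using that[of "max N1 N2"] by auto
qed

lemma bs_S_lincomb:
  assumes "s \<in> bs_S" "t \<in> bs_S"
  shows "(\<lambda>i. c * s i + d * t i) \<in> bs_S"
proof -
  obtain N where "\<And>i. i \<ge> N \<Longrightarrow> s i = 0" "\<And>i. i \<ge> N \<Longrightarrow> t i = 0"
    using bs_S_common_bound[OF assms] by blast
  then show ?thesis unfolding bs_S_iff by (intro exI[of _ N]) simp
qed

lemma dot_lincomb:
  assumes "s \<in> bs_S" "t \<in> bs_S"
  shows "dot a (\<lambda>i. c * s i + d * t i) = c * dot a s + d * dot a t"
proof -
  obtain N where N: "\<And>i. i \<ge> N \<Longrightarrow> s i = 0" "\<And>i. i \<ge> N \<Longrightarrow> t i = 0"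
    using bs_S_common_bound[OF assms] by blast
  then have "dot a (\<lambda>i. c * s i + d * t i) = (\<Sum>i<N. a i * (c * s i + d * t i))"
    by (intro dot_eq_sum) auto
  also have "\<dots> = c * (\<Sum>i<N. a i * s i) + d * (\<Sum>i<N. a i * t i)"
    by (simp add: algebra_simps sum.distrib sum_distrib_left)
  finally show ?thesis using dot_eq_sum[of N s a] dot_eq_sum[of N t a] N by simp
qed

lemma dot_lincomb_left:
  "dot (\<lambda>i. c * a i + d * b i) s = c * dot a s + d * dot b s"
  unfolding dot_def by (simp add: distrib_right sum.distrib sum_distrib_left mult.assoc)

lemma bs_S_add: "s \<in> bs_S \<Longrightarrow> t \<in> bs_S \<Longrightarrow> s + t \<in> bs_S"
  using bs_S_lincomb[of s t 1 1] by (simp add: plus_fun_def)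

lemma dot_add: "s \<in> bs_S \<Longrightarrow> t \<in> bs_S \<Longrightarrow> dot a (s + t) = dot a s + dot a t"
  using dot_lincomb[of s t a 1 1] by (simp add: plus_fun_def)

lemma dot_diff: "s \<in> bs_S \<Longrightarrow> t \<in> bs_S \<Longrightarrow> dot a (s - t) = dot a s - dot a t"
  using dot_lincomb[of s t a 1 "-1"] by (simp add: fun_diff_def)

lemma bs_S_0 [simp]: "0 \<in> bs_S"
  by (auto simp: bs_S_iff)

lemma dot_0 [simp]: "dot a 0 = 0"
  by (simp add: dot_def)

lemma unit_seq_in_bs_S [simp]: "unit_seq k \<in> bs_S"
  unfolding bs_S_iff unit_seq_def by (rule exI[of _ "Suc k"]) auto

lemma dot_unit_right [simp]: "dot a (unit_seq k) = a k"
proof -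
  have "{i. unit_seq k i \<noteq> 0} = {k}" by (auto simp: unit_seq_def)
  then show ?thesis by (simp add: dot_def unit_seq_def)
qed

lemma dot_unit_left [simp]:
  assumes "s \<in> bs_S"
  shows "dot (unit_seq k) s = s k"
proof -
  obtain N where N: "\<And>i. i \<ge> N \<Longrightarrow> s i = 0" using assms bs_S_iff by blast
  have "dot (unit_seq k) s = (\<Sum>i<max N (Suc k). unit_seq k i * s i)"
    using N by (intro dot_eq_sum) auto
  also have "\<dots> = s k" by (subst sum.remove[of _ k]) (auto simp: unit_seq_def)
  finally show ?thesis .
qed

section \<open>Integer linear algebra: homogeneous systems, joint kernels, and factoring through
  finitely many functionals\<close>

lemma homogeneous_system:
  fixes l :: "'a \<Rightarrow> 'b \<Rightarrow> int"
  assumes "finite J" "finite I" "card J < card I"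
  shows "\<exists>b. (\<exists>i\<in>I. b i \<noteq> 0) \<and> (\<forall>j\<in>J. (\<Sum>i\<in>I. b i * l i j) = 0)"
  using assms
proof (induction J arbitrary: I l rule: finite_induct)
  case empty
  then have "I \<noteq> {}" by auto
  then show ?case by (intro exI[of _ "\<lambda>_. 1"]) auto
next
  case (insert j J)
  show ?case
  proof (cases "\<forall>i\<in>I. l i j = 0")
    case True
    then show ?thesis using insert.IH[of I l] insert.prems insert.hyps by auto
  next
    case False
    \<comment> \<open>Gaussian elimination without division: the unknown p is eliminated from every
      equation by cross-multiplying with the pivot \<open>l p j\<close>.\<close>
    then obtain p where p: "p \<in> I" "l p j \<noteq> 0" by blast
    have "card J < card (I - {p})" using insert.prems insert.hyps p(1) by simp
    then obtain b where b: "\<exists>i\<in>I - {p}. b i \<noteq> 0"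
      "\<And>k. k \<in> J \<Longrightarrow> (\<Sum>i\<in>I - {p}. b i * (l p j * l i k - l i j * l p k)) = 0"
      using insert.IH[of "I - {p}" "\<lambda>i k. l p j * l i k - l i j * l p k"] insert.prems(1) by blast
    \<comment> \<open>Back-substitution: scaling the other unknowns by the pivot lets equation j be
      solved for unknown p in the integers.\<close>
    define b' where "b' i = (if i = p then - (\<Sum>i\<in>I - {p}. b i * l i j) else l p j * b i)" for i
    have sum: "(\<Sum>i\<in>I. b' i * l i k) = (\<Sum>i\<in>I - {p}. b i * (l p j * l i k - l i j * l p k))" for k
    proof -
      have "(\<Sum>i\<in>I. b' i * l i k) = b' p * l p k + (\<Sum>i\<in>I - {p}. b' i * l i k)"
        using p(1) insert.prems(1) by (simp add: sum.remove)
      also have "(\<Sum>i\<in>I - {p}. b' i * l i k) = (\<Sum>i\<in>I - {p}. l p j * b i * l i k)"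
        by (rule sum.cong) (auto simp: b'_def)
      finally show ?thesis
        by (simp add: b'_def algebra_simps sum_subtractf sum_distrib_left sum_distrib_right)
    qed
    have "(\<Sum>i\<in>I. b' i * l i j) = 0"
      unfolding sum by (rule sum.neutral) simp
    moreover have "\<exists>i\<in>I. b' i \<noteq> 0" using b(1) p(2) by (auto simp: b'_def)
    ultimately show ?thesis using b(2) sum by auto
  qed
qed

text \<open>The first \<open>card F + 1\<close> coordinates are more unknowns than the equations
  given by F.\<close>

lemma exists_nonzero_in_joint_kernel:
  assumes "finite F"
  shows "\<exists>t\<in>bs_S. (\<forall>a\<in>F. dot a t = 0) \<and> (\<exists>k. t k \<noteq> 0)"
proof -
  obtain b :: "nat \<Rightarrow> int" where b: "\<exists>i\<in>{..card F}. b i \<noteq> 0"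
    "\<forall>a\<in>F. (\<Sum>i\<in>{..card F}. b i * a i) = 0"
    using homogeneous_system[of F "{..card F}" "\<lambda>i a. a i"] assms by auto
  define t where "t i = (if i \<le> card F then b i else 0)" for i
  have "t \<in> bs_S" unfolding bs_S_iff t_def by (rule exI[of _ "Suc (card F)"]) auto
  moreover have "dot a t = (\<Sum>i\<in>{..card F}. b i * a i)" for a
  proof -
    have "dot a t = (\<Sum>i<Suc (card F). a i * t i)"
      by (rule dot_eq_sum) (simp add: t_def)
    also have "\<dots> = (\<Sum>i\<in>{..card F}. b i * a i)"
      unfolding lessThan_Suc_atMost by (intro sum.cong refl) (simp add: t_def)
    finally show ?thesis .
  qed
  moreover have "\<exists>k. t k \<noteq> 0" using b(1) by (auto simp: t_def)
  ultimately show ?thesis using b(2) by (intro bexI[of _ t]) simp_all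
qed

text \<open>Induction on F: pass to the kernel of one functional b inside V, then correct along an
  element \<open>s0\<close> with \<open>dot b s0\<close> nonzero. Letting V vary makes the induction
  possible. The denominator c is a product of such values of functionals in F, so a single c serves
  all k.\<close>

lemma factor_through_functionals:
  assumes "finite F" "V \<subseteq> bs_S"
    and "\<And>s t c d. s \<in> V \<Longrightarrow> t \<in> V \<Longrightarrow> (\<lambda>i. c * s i + d * t i) \<in> V"
    and "\<And>s k. s \<in> V \<Longrightarrow> \<forall>a\<in>F. dot a s = 0 \<Longrightarrow> dot (\<psi> k) s = 0"
  shows "\<exists>c v. c \<noteq> 0 \<and> (\<forall>s\<in>V. \<forall>k. c * dot (\<psi> k) s = (\<Sum>a\<in>F. dot a s * v a k))"
  using assms
proof (induction F arbitrary: V rule: finite_induct)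
  case empty
  then show ?case by (intro exI[of _ 1]) auto
next
  case (insert b F)
  let ?W = "{s \<in> V. dot b s = 0}"
  have "\<exists>c v. c \<noteq> 0 \<and> (\<forall>s\<in>?W. \<forall>k. c * dot (\<psi> k) s = (\<Sum>a\<in>F. dot a s * v a k))"
  proof (rule insert.IH)
    show "(\<lambda>i. c * s i + d * t i) \<in> ?W" if "s \<in> ?W" "t \<in> ?W" for s t c d
      using that insert.prems by (auto simp: dot_lincomb subset_iff)
  qed (use insert.prems in auto)
  then obtain c v where c: "c \<noteq> 0"
    and v: "\<And>s k. s \<in> V \<Longrightarrow> dot b s = 0 \<Longrightarrow> c * dot (\<psi> k) s = (\<Sum>a\<in>F. dot a s * v a k)"
    by blast
  show ?case
  proof (cases "\<forall>s\<in>V. dot b s = 0")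
    case True
    then show ?thesis using c v insert.hyps by (intro exI[of _ c] exI[of _ v]) auto
  next
    case False
    then obtain s0 where s0: "s0 \<in> V" "dot b s0 \<noteq> 0" by blast
    define d where "d = dot b s0"
    \<comment> \<open>The new vector \<open>w b\<close> is the error of the old factorization at
      \<open>s0\<close>; the other vectors are scaled by d to clear the denominator.\<close>
    define w where "w a = (\<lambda>k. if a = b then c * dot (\<psi> k) s0 - (\<Sum>a\<in>F. dot a s0 * v a k) else d * v a k)" for a
    have "c * d * dot (\<psi> k) s = (\<Sum>a\<in>insert b F. dot a s * w a k)" if s: "s \<in> V" for s k
    proof -
      \<comment> \<open>This combination of s and \<open>s0\<close> is killed by b, so the identity
        on \<open>?W\<close> applies to it.\<close>
      let ?t = "\<lambda>i. d * s i + (- dot b s) * s0 i"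
      have dt: "dot a ?t = d * dot a s - dot b s * dot a s0" for a
        using s s0 insert.prems(1) by (subst dot_lincomb) auto
      have "c * dot (\<psi> k) ?t = (\<Sum>a\<in>F. dot a ?t * v a k)"
      proof (rule v)
        show "?t \<in> V" by (rule insert.prems(2)[OF s s0(1)])
        show "dot b ?t = 0" unfolding dt by (simp add: d_def)
      qed
      then have "c * d * dot (\<psi> k) s = dot b s * (c * dot (\<psi> k) s0) +
          (\<Sum>a\<in>F. (d * dot a s - dot b s * dot a s0) * v a k)"
        unfolding dt by (simp add: algebra_simps)
      also have "\<dots> = dot b s * w b k + (\<Sum>a\<in>F. dot a s * (d * v a k))"
        by (simp add: w_def algebra_simps sum_subtractf sum_distrib_left)
      also have "(\<Sum>a\<in>F. dot a s * (d * v a k)) = (\<Sum>a\<in>F. dot a s * w a k)"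
        using insert.hyps by (intro sum.cong) (auto simp: w_def)
      finally show ?thesis using insert.hyps by simp
    qed
    then show ?thesis using c s0(2) by (intro exI[of _ "c * d"] exI[of _ w]) (auto simp: d_def)
  qed
qed

subsection \<open>Integral values of \<open>\<int>\<close>-adic sums\<close>

text \<open>Convergence to an integer in the completion, expressed through congruences of partial
  sums, so that the completion itself is never constructed.\<close>

definition dot_lim :: "(nat \<Rightarrow> int) \<Rightarrow> (nat \<Rightarrow> int) \<Rightarrow> int \<Rightarrow> bool" where
  "dot_lim a x z \<longleftrightarrow> (\<forall>M. M \<noteq> 0 \<longrightarrow> (\<forall>\<^sub>F N in sequentially. M dvd (\<Sum>i<N. a i * x i) - z))"

abbreviation integral_at :: "(nat \<Rightarrow> int) \<Rightarrow> (nat \<Rightarrow> int) \<Rightarrow> bool" where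
  "integral_at a x \<equiv> \<exists>z. dot_lim a x z"

lemma int_eq_if_all_dvd_diff:
  fixes z w :: int
  assumes "\<And>M. M \<noteq> 0 \<Longrightarrow> M dvd z - w"
  shows "z = w"
proof (rule ccontr)
  assume "z \<noteq> w"
  then have "\<bar>z - w\<bar> + 1 \<le> \<bar>z - w\<bar>"
    using assms[of "\<bar>z - w\<bar> + 1"] by (intro zdvd_imp_le) auto
  then show False by simp
qed

lemma dot_lim_unique:
  assumes "dot_lim a x z" "dot_lim a x w"
  shows "z = w"
proof (rule int_eq_if_all_dvd_diff)
  fix M :: int assume "M \<noteq> 0"
  then have "\<forall>\<^sub>F N in sequentially. M dvd (\<Sum>i<N. a i * x i) - z \<and> M dvd (\<Sum>i<N. a i * x i) - w"
    using assms unfolding dot_lim_def by (intro eventually_conj) auto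
  then obtain N where "M dvd (\<Sum>i<N. a i * x i) - z" "M dvd (\<Sum>i<N. a i * x i) - w"
    by (metis (no_types, lifting) eventually_sequentially order_refl)
  from dvd_diff[OF this(2,1)] show "M dvd z - w" by simp
qed

lemma dot_lim_lincomb_right:
  assumes "dot_lim a x z" "dot_lim a y w"
  shows "dot_lim a (\<lambda>i. c * x i + d * y i) (c * z + d * w)"
  unfolding dot_lim_def
proof (intro allI impI)
  fix M :: int assume "M \<noteq> 0"
  then have "\<forall>\<^sub>F N in sequentially. M dvd (\<Sum>i<N. a i * x i) - z"
      "\<forall>\<^sub>F N in sequentially. M dvd (\<Sum>i<N. a i * y i) - w"
    using assms unfolding dot_lim_def by auto
  then show "\<forall>\<^sub>F N in sequentially. M dvd (\<Sum>i<N. a i * (c * x i + d * y i)) - (c * z + d * w)"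
  proof eventually_elim
    case (elim N)
    then have "M dvd c * ((\<Sum>i<N. a i * x i) - z) + d * ((\<Sum>i<N. a i * y i) - w)"
      by (intro dvd_add dvd_mult)
    then show ?case by (simp add: algebra_simps sum.distrib sum_distrib_left)
  qed
qed

lemma dot_lim_commute: "dot_lim a x z \<longleftrightarrow> dot_lim x a z"
  by (simp add: dot_lim_def mult.commute)

lemma dot_lim_lincomb_left:
  assumes "dot_lim a x z" "dot_lim b x w"
  shows "dot_lim (\<lambda>i. c * a i + d * b i) x (c * z + d * w)"
  using assms dot_lim_lincomb_right by (simp add: dot_lim_commute[of _ x])

lemma dot_lim_bs_S:
  assumes "s \<in> bs_S"
  shows "dot_lim a s (dot a s)"
proof -
  obtain N0 where N0: "\<And>i. i \<ge> N0 \<Longrightarrow> s i = 0" using assms bs_S_iff by blast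
  have "(\<Sum>i<N. a i * s i) = dot a s" if "N \<ge> N0" for N
    using dot_eq_sum[of N s a] N0 that by simp
  then show ?thesis unfolding dot_lim_def eventually_sequentially by (metis diff_self dvd_0_right)
qed

lemma dot_lim_unit_left: "dot_lim (unit_seq k) x (x k)"
proof -
  have "(\<Sum>i<N. unit_seq k i * x i) = x k" if "N \<ge> Suc k" for N
    using that by (subst sum.remove[of _ k]) (auto simp: unit_seq_def)
  then show ?thesis unfolding dot_lim_def eventually_sequentially by (metis diff_self dvd_0_right)
qed

lemma sum_cong_dvd:
  fixes f g :: "'a \<Rightarrow> int"
  assumes "\<And>i. i \<in> I \<Longrightarrow> M dvd f i - g i"
  shows "M dvd sum f I - sum g I"
  unfolding sum_subtractf[symmetric] by (rule dvd_sum) (rule assms)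

text \<open>Modulo M the sequence x may be replaced by a finitely supported one. Limits are thereby
  computed from finite approximations.\<close>

lemma eventually_dvd_sum_diff_dot:
  assumes "s \<in> bs_S" "\<And>i. M dvd x i - s i"
  shows "\<forall>\<^sub>F N in sequentially. M dvd (\<Sum>i<N. a i * x i) - dot a s"
proof -
  obtain N0 where N0: "\<And>i. i \<ge> N0 \<Longrightarrow> s i = 0" using assms bs_S_iff by blast
  have "M dvd (\<Sum>i<N. a i * x i) - dot a s" if "N \<ge> N0" for N
  proof -
    have "dot a s = (\<Sum>i<N. a i * s i)"
      using dot_eq_sum[of N s a] N0 that by simp
    moreover have "M dvd (\<Sum>i<N. a i * x i) - (\<Sum>i<N. a i * s i)"
      using assms(2) by (intro sum_cong_dvd) (simp flip: right_diff_distrib)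
    ultimately show ?thesis by simp
  qed
  then show ?thesis unfolding eventually_sequentially by blast
qed

text \<open>The increments of \<open>\<sigma>\<close> lie in a decreasing sequence of subgroups that become divisible under
  every \<open>\<rho> k\<close>; so once \<open>\<rho> k\<close> misses its target modulo \<open>M\<close>, later steps can be kept from undoing this.\<close>

lemma avoid_targets:
  fixes T :: "nat \<Rightarrow> 'a::ab_group_add set" and \<rho> :: "nat \<Rightarrow> 'a \<Rightarrow> 'b \<Rightarrow> int"
  assumes T0: "\<And>m. 0 \<in> T m"
    and T_add: "\<And>m s t. s \<in> T m \<Longrightarrow> t \<in> T m \<Longrightarrow> s + t \<in> T m"
    and T_mono: "\<And>m n. m \<le> n \<Longrightarrow> T n \<subseteq> T m"
    and \<rho>_add: "\<And>k s t i. s \<in> T 0 \<Longrightarrow> t \<in> T 0 \<Longrightarrow> \<rho> k (s + t) i = \<rho> k s i + \<rho> k t i"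
    and nonzero: "\<And>k m. \<exists>t\<in>T m. \<exists>i. \<rho> k t i \<noteq> 0"
    and small: "\<And>k M. M \<noteq> 0 \<Longrightarrow> \<exists>m. \<forall>t\<in>T m. \<forall>i. M dvd \<rho> k t i"
  shows "\<exists>\<sigma>. (\<forall>l. \<sigma> l \<in> T 0) \<and> (\<forall>k l. k \<le> l \<longrightarrow> \<sigma> l - \<sigma> k \<in> T k) \<and>
    (\<forall>k. \<exists>M\<noteq>0. \<exists>i. \<forall>l>k. \<not> M dvd \<rho> k (\<sigma> l) i - g k i)"
proof -
  \<comment> \<open>A state is a pair (s, m): the sum so far, and the level m such that all later
    increments are taken from \<open>T m\<close>. Step k makes \<open>\<rho> k\<close> miss its
    target for good.\<close>
  define P where "P k p \<longleftrightarrow> fst p \<in> T 0 \<and> k \<le> snd p" for k :: nat and p :: "'a \<times> nat"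
  define Q where "Q k p q \<longleftrightarrow> fst q - fst p \<in> T (snd p) \<and> snd p \<le> snd q \<and>
    (\<exists>M i. M \<noteq> 0 \<and> \<not> M dvd \<rho> k (fst q) i - g k i \<and> (\<forall>t\<in>T (snd q). M dvd \<rho> k t i))"
    for k p q
  have "\<exists>f. \<forall>n. P n (f n) \<and> Q n (f n) (f (Suc n))"
  proof (rule dependent_nat_choice)
    show "\<exists>p. P 0 p" using T0 by (auto simp: P_def)
  next
    fix p k assume p: "P k p"
    obtain s m where [simp]: "p = (s, m)" by force
    have s: "s \<in> T 0" "k \<le> m" using p by (auto simp: P_def)
    obtain t i where t: "t \<in> T m" "\<rho> k t i \<noteq> 0" using nonzero by blast
    have t0: "t \<in> T 0" using t(1) T_mono[of 0 m] by auto
    obtain s' where s': "s' - s \<in> T m" "s' \<in> T 0" "\<rho> k s' i \<noteq> g k i"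
    proof (cases "\<rho> k s i = g k i")
      case True
      then show ?thesis
        using that[of "s + t"] t t0 s(1) \<rho>_add T_add by simp
    qed (use that[of s] s T0 in auto)
    \<comment> \<open>A modulus larger than the absolute value of the nonzero difference cannot
      divide it.\<close>
    define M where "M = \<bar>\<rho> k s' i - g k i\<bar> + 1"
    have M: "M \<noteq> 0" "\<not> M dvd \<rho> k s' i - g k i"
      using s'(3) zdvd_imp_le[of M "\<bar>\<rho> k s' i - g k i\<bar>"] by (auto simp: M_def)
    then obtain m' where m': "\<forall>t\<in>T m'. \<forall>i. M dvd \<rho> k t i" using small by blast
    \<comment> \<open>Level \<open>m'\<close> keeps later increments from changing
      \<open>\<rho> k\<close> modulo M; \<open>Suc m\<close> keeps the level at least the stage
      number.\<close>
    have "Q k p (s', max (Suc m) m')"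
      unfolding Q_def using s' M m' T_mono[of m' "max (Suc m) m'"] by auto
    moreover have "P (Suc k) (s', max (Suc m) m')"
      using s s' by (auto simp: P_def)
    ultimately show "\<exists>q. P (Suc k) q \<and> Q k p q" by blast
  qed
  then obtain f where P: "\<And>n. P n (f n)" and Q: "\<And>n. Q n (f n) (f (Suc n))" by blast
  define \<sigma> where "\<sigma> n = fst (f n)" for n
  have diff: "\<sigma> l - \<sigma> k \<in> T (snd (f k))" if "k \<le> l" for k l
    using that
  proof (induction l rule: dec_induct)
    case base
    then show ?case by (simp add: T0)
  next
    case (step l)
    have "snd (f k) \<le> snd (f l)" using step.hyps(1)
      by (rule lift_Suc_mono_le[rotated]) (use Q in \<open>auto simp: Q_def\<close>)
    then have "\<sigma> (Suc l) - \<sigma> l \<in> T (snd (f k))"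
      using Q[of l] T_mono unfolding Q_def \<sigma>_def by blast
    from T_add[OF this step.IH] show ?case by simp
  qed
  show ?thesis
  proof (intro exI[of _ \<sigma>] conjI allI impI)
    show \<sigma>0: "\<sigma> l \<in> T 0" for l using P by (auto simp: P_def \<sigma>_def)
    show "\<sigma> l - \<sigma> k \<in> T k" if "k \<le> l" for k l
      using diff[OF that] T_mono[of k "snd (f k)"] P[of k] by (auto simp: P_def)
    fix k
    obtain M i where M: "M \<noteq> 0" "\<not> M dvd \<rho> k (\<sigma> (Suc k)) i - g k i"
      "\<forall>t\<in>T (snd (f (Suc k))). M dvd \<rho> k t i"
      using Q[of k] unfolding Q_def \<sigma>_def by blast
    have "\<not> M dvd \<rho> k (\<sigma> l) i - g k i" if "k < l" for l
    proof
      assume *: "M dvd \<rho> k (\<sigma> l) i - g k i"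
      have d: "\<sigma> l - \<sigma> (Suc k) \<in> T (snd (f (Suc k)))" using diff that by simp
      then have "\<rho> k (\<sigma> (Suc k) + (\<sigma> l - \<sigma> (Suc k))) i = \<rho> k (\<sigma> (Suc k)) i + \<rho> k (\<sigma> l - \<sigma> (Suc k)) i"
        using \<sigma>0 T_mono[of 0 "snd (f (Suc k))"] by (intro \<rho>_add) auto
      moreover have "M dvd \<rho> k (\<sigma> l - \<sigma> (Suc k)) i" using d M(3) by blast
      ultimately have "M dvd \<rho> k (\<sigma> (Suc k)) i - g k i"
        using dvd_diff[OF * \<open>M dvd \<rho> k (\<sigma> l - \<sigma> (Suc k)) i\<close>] by (simp add: algebra_simps)
      with M(2) show False by simp
    qed
    with M(1) show "\<exists>M\<noteq>0. \<exists>i. \<forall>l>k. \<not> M dvd \<rho> k (\<sigma> l) i - g k i" by blast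
  qed
qed

subsection \<open>The group \<open>P\<close> and the closure \<open>D\<close>\<close>

lemma bs_P_simps [simp]:
  "carrier bs_P = UNIV"
  "x \<otimes>\<^bsub>bs_P\<^esub> y = (\<lambda>i. x i + y i)"
  "\<one>\<^bsub>bs_P\<^esub> = (\<lambda>i. 0)"
  by (auto simp: bs_P_def product_group_def)

lemma comm_group_bs_P: "comm_group bs_P"
proof (rule comm_groupI)
  show "\<exists>y\<in>carrier bs_P. y \<otimes>\<^bsub>bs_P\<^esub> x = \<one>\<^bsub>bs_P\<^esub>" for x
    by (rule bexI[of _ "\<lambda>i. - x i"]) auto
qed (auto simp: algebra_simps)

interpretation bs_P: comm_group bs_P
  by (rule comm_group_bs_P)

lemma inv_bs_P [simp]: "inv\<^bsub>bs_P\<^esub> x = (\<lambda>i. - x i)"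
  by (rule bs_P.inv_equality) auto

lemma nat_pow_bs_P [simp]: "x [^]\<^bsub>bs_P\<^esub> (n::nat) = (\<lambda>i. int n * x i)"
  by (induction n) (auto simp: algebra_simps)

lemma int_pow_bs_P [simp]: "x [^]\<^bsub>bs_P\<^esub> (n::int) = (\<lambda>i. n * x i)"
  by (auto simp: int_pow_def2)

lemma subgroup_bs_P_iff:
  "subgroup H bs_P \<longleftrightarrow> (\<lambda>i. 0) \<in> H \<and> (\<forall>x\<in>H. \<forall>y\<in>H. (\<lambda>i. x i + y i) \<in> H) \<and> (\<forall>x\<in>H. (\<lambda>i. - x i) \<in> H)"
  unfolding subgroup_def by auto

lemma subgroup_bs_S: "subgroup bs_S bs_P"
  unfolding subgroup_bs_P_iff
proof (intro conjI ballI)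
  show "(\<lambda>i. x i + y i) \<in> bs_S" if "x \<in> bs_S" "y \<in> bs_S" for x y
    using bs_S_lincomb[OF that, of 1 1] by simp
  show "(\<lambda>i. - x i) \<in> bs_S" if "x \<in> bs_S" for x
    using bs_S_lincomb[OF that that, of "-1" 0] by simp
qed (auto simp: bs_S_iff)

lemma bs_S_coset_eq_iff: "bs_S #>\<^bsub>bs_P\<^esub> x = bs_S #>\<^bsub>bs_P\<^esub> y \<longleftrightarrow> (\<lambda>i. x i - y i) \<in> bs_S"
proof
  assume "bs_S #>\<^bsub>bs_P\<^esub> x = bs_S #>\<^bsub>bs_P\<^esub> y"
  then have "x \<in> bs_S #>\<^bsub>bs_P\<^esub> y"
    using bs_P.rcos_self[OF _ subgroup_bs_S, of x] by simp
  then show "(\<lambda>i. x i - y i) \<in> bs_S"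
    by (auto simp: r_coset_def)
next
  assume "(\<lambda>i. x i - y i) \<in> bs_S"
  then have "x \<in> bs_S #>\<^bsub>bs_P\<^esub> y"
    by (force simp: r_coset_def)
  then show "bs_S #>\<^bsub>bs_P\<^esub> x = bs_S #>\<^bsub>bs_P\<^esub> y"
    using bs_P.repr_independence[OF _ _ subgroup_bs_S] by simp
qed

lemma normal_bs_S: "bs_S \<lhd> bs_P"
  by (rule bs_P.subgroup_imp_normal[OF subgroup_bs_S])

lemma int_pow_bs_P_Mod_bs_S:
  "(bs_S #>\<^bsub>bs_P\<^esub> x) [^]\<^bsub>bs_P Mod bs_S\<^esub> (n::int) = bs_S #>\<^bsub>bs_P\<^esub> (\<lambda>i. n * x i)"
  using normal.FactGroup_int_pow[OF normal_bs_S, of x n] by simp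

lemma comm_group_bs_P_Mod_bs_S: "comm_group (bs_P Mod bs_S)"
  by (rule bs_P.abelian_FactGroup[OF subgroup_bs_S])

text \<open>If the coset of x is M times a coset in the divisible part, then x differs from a
  multiple of M by a finitely supported sequence. Conversely, the sequences on the right have a
  divisible image in P/S, because their entries can eventually be divided by n.\<close>

lemma bs_D_iff: "x \<in> bs_D \<longleftrightarrow> (\<forall>M. M \<noteq> 0 \<longrightarrow> (\<forall>\<^sub>F i in sequentially. M dvd x i))"
proof
  assume x: "x \<in> bs_D"
  show "\<forall>M. M \<noteq> 0 \<longrightarrow> (\<forall>\<^sub>F i in sequentially. M dvd x i)"
  proof (intro allI impI)
    fix M :: int assume M: "M \<noteq> 0"
    let ?H = "divisible_part (bs_P Mod bs_S)"
    have "divisible_subgroup ?H (bs_P Mod bs_S)"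
      by (rule divisible_part_greatest(1)[OF comm_group_bs_P_Mod_bs_S])
    then have sub: "subgroup ?H (bs_P Mod bs_S)" and "multiples (bs_P Mod bs_S) M ?H = ?H"
      using M by (auto simp: divisible_subgroup_def)
    moreover have "bs_S #>\<^bsub>bs_P\<^esub> x \<in> ?H" using x by (simp add: bs_D_def)
    ultimately obtain Y where Y: "Y \<in> ?H" "bs_S #>\<^bsub>bs_P\<^esub> x = Y [^]\<^bsub>bs_P Mod bs_S\<^esub> M"
      by (auto simp: multiples_def)
    obtain y where "Y = bs_S #>\<^bsub>bs_P\<^esub> y"
      using subgroup.mem_carrier[OF sub Y(1)] by (auto simp: FactGroup_def RCOSETS_def)
    then have "(\<lambda>i. x i - M * y i) \<in> bs_S"
      using Y(2) by (simp add: int_pow_bs_P_Mod_bs_S bs_S_coset_eq_iff)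
    then have "\<forall>\<^sub>F i in sequentially. x i - M * y i = 0"
      by (simp add: bs_S_iff eventually_sequentially)
    then show "\<forall>\<^sub>F i in sequentially. M dvd x i"
      by eventually_elim simp
  qed
next
  assume x: "\<forall>M. M \<noteq> 0 \<longrightarrow> (\<forall>\<^sub>F i in sequentially. M dvd x i)"
  define C where "C = {x::nat \<Rightarrow> int. \<forall>M. M \<noteq> 0 \<longrightarrow> (\<forall>\<^sub>F i in sequentially. M dvd x i)}"
  have "subgroup C bs_P"
    unfolding subgroup_bs_P_iff C_def by (auto intro: eventually_elim2)
  moreover have hom: "group_hom bs_P (bs_P Mod bs_S) (\<lambda>x. bs_S #>\<^bsub>bs_P\<^esub> x)"
    using normal.r_coset_hom_Mod[OF normal_bs_S] normal.factorgroup_is_group[OF normal_bs_S]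
    by (simp add: group_hom_def group_hom_axioms_def)
  ultimately have "subgroup ((\<lambda>x. bs_S #>\<^bsub>bs_P\<^esub> x) ` C) (bs_P Mod bs_S)"
    by (rule group_hom.subgroup_img_is_subgroup[rotated])
  moreover have "\<exists>Y\<in>(\<lambda>x. bs_S #>\<^bsub>bs_P\<^esub> x) ` C. X = Y [^]\<^bsub>bs_P Mod bs_S\<^esub> n"
    if X: "X \<in> (\<lambda>x. bs_S #>\<^bsub>bs_P\<^esub> x) ` C" and n: "n \<noteq> 0" for X and n :: int
  proof -
    obtain x where x: "x \<in> C" "X = bs_S #>\<^bsub>bs_P\<^esub> x" using X by blast
    \<comment> \<open>The default 0 is taken at only finitely many indices, so \<open>n * y\<close>
      and x lie in the same coset of S.\<close>
    define y where "y i = (if n dvd x i then x i div n else 0)" for i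
    have "\<forall>\<^sub>F i in sequentially. n dvd x i" using x(1) n by (simp add: C_def)
    then have "\<forall>\<^sub>F i in sequentially. x i - n * y i = 0"
      by eventually_elim (simp add: y_def)
    then have "(\<lambda>i. x i - n * y i) \<in> bs_S"
      by (simp add: bs_S_iff eventually_sequentially)
    then have "X = (bs_S #>\<^bsub>bs_P\<^esub> y) [^]\<^bsub>bs_P Mod bs_S\<^esub> n"
      by (simp add: x(2) int_pow_bs_P_Mod_bs_S bs_S_coset_eq_iff)
    moreover have "y \<in> C"
      unfolding C_def
    proof (intro CollectI allI impI)
      fix M :: int assume "M \<noteq> 0"
      then have "\<forall>\<^sub>F i in sequentially. n * M dvd x i" using x(1) n by (simp add: C_def)
      then show "\<forall>\<^sub>F i in sequentially. M dvd y i"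
      proof eventually_elim
        case (elim i)
        then show ?case using n by (auto simp: y_def elim!: dvdE)
      qed
    qed
    ultimately show ?thesis by blast
  qed
  ultimately have "divisible_subgroup ((\<lambda>x. bs_S #>\<^bsub>bs_P\<^esub> x) ` C) (bs_P Mod bs_S)"
    by (rule divisible_subgroupI[OF comm_group_bs_P_Mod_bs_S])
  then have "(\<lambda>x. bs_S #>\<^bsub>bs_P\<^esub> x) ` C \<subseteq> divisible_part (bs_P Mod bs_S)"
    by (rule divisible_part_greatest(2)[OF comm_group_bs_P_Mod_bs_S])
  then show "x \<in> bs_D" using x by (auto simp: bs_D_def C_def)
qed

subsection \<open>Generic elements and generic functionals\<close>

lemma dvd_fact_nat_abs:
  fixes M :: int
  assumes "M \<noteq> 0" "nat \<bar>M\<bar> \<le> n"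
  shows "M dvd fact n"
proof -
  have "nat \<bar>M\<bar> dvd fact n" using assms by (intro dvd_fact) auto
  then have "int (nat \<bar>M\<bar>) dvd int (fact n)" by (simp only: int_dvd_int_iff)
  then show ?thesis by simp
qed

text \<open>The generic x is a limit of partial sums \<open>\<sigma> l\<close>. An increment in
  \<open>T m\<close> is m! times a common zero of the first m functionals of A: the factor puts x
  into D, and the vanishing freezes each functional of A after finitely many stages, so that its
  value is an integer. Hypothesis \<open>nz\<close> leaves room to move each \<open>\<psi>\<close>
  away from its target.\<close>

lemma exists_integral_avoiding:
  assumes A: "countable A" "range unit_seq \<subseteq> A" and R: "countable R" "R \<noteq> {}"
    and nz: "\<And>\<psi> g F. (\<psi>, g) \<in> R \<Longrightarrow> finite F \<Longrightarrow> F \<subseteq> A \<Longrightarrow>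
      \<exists>t\<in>bs_S. (\<forall>a\<in>F. dot a t = 0) \<and> (\<exists>k. dot (\<psi> k) t \<noteq> 0)"
  shows "\<exists>x\<in>bs_D. (\<forall>a\<in>A. integral_at a x) \<and> (\<forall>(\<psi>, g)\<in>R. \<not> (\<forall>k. dot_lim (\<psi> k) x (g k)))"
proof -
  define a where "a = from_nat_into A"
  define r where "r = from_nat_into R"
  have ran: "range a = A" "range r = R"
    using A R by (auto simp: a_def r_def intro!: range_from_nat_into)
  define T where "T m = {s. \<exists>t\<in>bs_S. s = (\<lambda>i. fact m * t i) \<and> (\<forall>j<m. dot (a j) t = 0)}" for m
  have T_S: "s \<in> bs_S" if "s \<in> T m" for s m
    using that bs_S_lincomb[of _ _ "fact m" 0] by (auto simp: T_def)
  have T_ker: "dot (a j) s = 0" if "s \<in> T m" "j < m" for s m j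
    using that dot_lincomb[of _ _ "a j" "fact m" 0] by (auto simp: T_def)
  have T_dvd: "fact m dvd s i" if "s \<in> T m" for s m i
    using that by (auto simp: T_def)
  have "\<exists>\<sigma>. (\<forall>l. \<sigma> l \<in> T 0) \<and> (\<forall>k l. k \<le> l \<longrightarrow> \<sigma> l - \<sigma> k \<in> T k) \<and>
    (\<forall>k. \<exists>M\<noteq>0. \<exists>i. \<forall>l>k. \<not> M dvd dot (fst (r k) i) (\<sigma> l) - snd (r k) i)"
  proof (rule avoid_targets)
    show "0 \<in> T m" for m by (auto simp: T_def fun_eq_iff intro!: bexI[of _ 0])
    show "s + t \<in> T m" if st: "s \<in> T m" "t \<in> T m" for s t m
    proof -
      obtain s' where s': "s' \<in> bs_S" "s = (\<lambda>i. fact m * s' i)" "\<forall>j<m. dot (a j) s' = 0"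
        using st by (auto simp: T_def)
      obtain t' where t': "t' \<in> bs_S" "t = (\<lambda>i. fact m * t' i)" "\<forall>j<m. dot (a j) t' = 0"
        using st by (auto simp: T_def)
      show ?thesis unfolding T_def
        using s' t' by (auto intro!: bexI[of _ "s' + t'"] simp: bs_S_add dot_add algebra_simps fun_eq_iff)
    qed
    show "T n \<subseteq> T m" if mn: "m \<le> n" for m n
    proof
      fix s assume "s \<in> T n"
      then obtain t where t: "t \<in> bs_S" "s = (\<lambda>i. fact n * t i)" "\<forall>j<n. dot (a j) t = 0"
        by (auto simp: T_def)
      obtain c where c: "(fact n :: int) = fact m * c"
        using fact_dvd[OF mn] by (auto simp: dvd_def)
      show "s \<in> T m"
        unfolding T_def using t c mn bs_S_lincomb[OF t(1) t(1), of c 0]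
          dot_lincomb[OF t(1) t(1), of _ c 0]
        by (auto intro!: bexI[of _ "\<lambda>i. c * t i"] simp: mult.assoc)
    qed
    show "dot (fst (r k) i) (s + t) = dot (fst (r k) i) s + dot (fst (r k) i) t"
      if "s \<in> T 0" "t \<in> T 0" for k s t i
      using that T_S by (simp add: dot_add)
    show "\<exists>t\<in>T m. \<exists>i. dot (fst (r k) i) t \<noteq> 0" for k m
    proof -
      have "(fst (r k), snd (r k)) \<in> R" using ran(2) by auto
      moreover have "a ` {..<m} \<subseteq> A" using ran(1) by auto
      ultimately obtain t i where t: "t \<in> bs_S" "\<forall>j<m. dot (a j) t = 0" "dot (fst (r k) i) t \<noteq> 0"
        using nz[of "fst (r k)" "snd (r k)" "a ` {..<m}"] by auto
      have "dot (fst (r k) i) (\<lambda>i. fact m * t i) \<noteq> 0"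
        using dot_lincomb[OF t(1) t(1), of _ "fact m" 0] t(3) by simp
      then show ?thesis using t by (auto simp: T_def)
    qed
    show "\<exists>m. \<forall>t\<in>T m. \<forall>i. M dvd dot (fst (r k) i) t" if "M \<noteq> 0" for k and M :: int
    proof (intro exI ballI allI)
      fix t i assume "t \<in> T (nat \<bar>M\<bar>)"
      moreover have "M dvd fact (nat \<bar>M\<bar>)" by (rule dvd_fact_nat_abs) (use that in auto)
      ultimately have "M dvd t i" for i using T_dvd dvd_trans by blast
      then show "M dvd dot (fst (r k) i) t"
        unfolding dot_def by (intro dvd_sum) simp
    qed
  qed
  then obtain \<sigma> where \<sigma>0: "\<And>l. \<sigma> l \<in> bs_S" and \<sigma>: "\<And>k l. k \<le> l \<Longrightarrow> \<sigma> l - \<sigma> k \<in> T k"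
    and avoid: "\<And>k. \<exists>M\<noteq>0. \<exists>i. \<forall>l>k. \<not> M dvd dot (fst (r k) i) (\<sigma> l) - snd (r k) i"
    using T_S by metis
  have stable: "dot (a j) (\<sigma> l) = dot (a j) (\<sigma> (Suc j))" if "Suc j \<le> l" for j l
    using T_ker[OF \<sigma>[OF that], of j] \<sigma>0 by (simp add: dot_diff)
  \<comment> \<open>Since A contains \<open>unit_seq i\<close>, coordinate i is constant from the
    stage after the one that lists it.\<close>
  define x where "x i = \<sigma> (Suc (SOME j. a j = unit_seq i)) i" for i
  have x_eq: "\<exists>K. \<forall>l\<ge>K. \<sigma> l i = x i" for i
  proof -
    define j where "j = (SOME j. a j = unit_seq i)"
    have "\<exists>j. a j = unit_seq i" using A(2) ran(1) by (metis rangeE range_subsetD)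
    then have aj: "a j = unit_seq i" unfolding j_def by (rule someI_ex)
    have "\<sigma> l i = x i" if "Suc j \<le> l" for l
      using stable[OF that] \<sigma>0 by (simp add: aj x_def flip: j_def)
    then show ?thesis by blast
  qed
  have x_dvd: "fact k dvd x i - \<sigma> k i" for k i
  proof -
    obtain K where "\<forall>l\<ge>K. \<sigma> l i = x i" using x_eq by blast
    then have "\<sigma> (max K k) i = x i" by simp
    then show ?thesis using T_dvd[OF \<sigma>[of k "max K k"], of i] by simp
  qed
  have x_dvd': "\<exists>l\<ge>k. \<forall>i. M dvd x i - \<sigma> l i" if "M \<noteq> 0" for M k
  proof -
    have "M dvd fact (max k (nat \<bar>M\<bar>))" by (rule dvd_fact_nat_abs) (use that in auto)
    then show ?thesis using x_dvd dvd_trans by (metis max.cobounded1)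
  qed
  show ?thesis
  proof (intro bexI[of _ x] conjI ballI)
    show "x \<in> bs_D"
      unfolding bs_D_iff
    proof (intro allI impI)
      fix M :: int assume "M \<noteq> 0"
      then obtain l where l: "\<And>i. M dvd x i - \<sigma> l i" using x_dvd'[of M 0] by blast
      have "\<forall>\<^sub>F i in sequentially. \<sigma> l i = 0"
        using \<sigma>0[of l] by (simp add: bs_S_iff eventually_sequentially)
      then show "\<forall>\<^sub>F i in sequentially. M dvd x i"
        by eventually_elim (metis l diff_zero)
    qed
    show "integral_at b x" if "b \<in> A" for b
    proof -
      obtain j where j: "b = a j" using \<open>b \<in> A\<close> ran(1) by blast
      have "dot_lim b x (dot b (\<sigma> (Suc j)))"
        unfolding dot_lim_def
      proof (intro allI impI)
        fix M :: int assume "M \<noteq> 0"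
        then obtain l where l: "l \<ge> Suc j" "\<And>i. M dvd x i - \<sigma> l i"
          using x_dvd' by blast
        show "\<forall>\<^sub>F N in sequentially. M dvd (\<Sum>i<N. b i * x i) - dot b (\<sigma> (Suc j))"
          using eventually_dvd_sum_diff_dot[OF \<sigma>0 l(2), of b] stable[OF l(1)] j by simp
      qed
      then show ?thesis by blast
    qed
    fix p assume "p \<in> R"
    then obtain k where k: "p = r k" using ran(2) by blast
    obtain M i where M: "M \<noteq> 0" "\<And>l. l > k \<Longrightarrow> \<not> M dvd dot (fst (r k) i) (\<sigma> l) - snd (r k) i"
      using avoid by blast
    obtain l where l: "l \<ge> Suc k" "\<And>i. M dvd x i - \<sigma> l i" using x_dvd'[OF M(1)] by blast
    have "\<not> dot_lim (fst (r k) i) x (snd (r k) i)"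
    proof
      assume "dot_lim (fst (r k) i) x (snd (r k) i)"
      \<comment> \<open>The same partial sum would be congruent modulo M to the target and to the
        value at \<open>\<sigma> l\<close>, which were kept incongruent.\<close>
      then have "\<forall>\<^sub>F N in sequentially. M dvd (\<Sum>j<N. fst (r k) i j * x j) - snd (r k) i \<and>
          M dvd (\<Sum>j<N. fst (r k) i j * x j) - dot (fst (r k) i) (\<sigma> l)"
        using M(1) eventually_dvd_sum_diff_dot[OF \<sigma>0 l(2)]
        by (intro eventually_conj) (auto simp: dot_lim_def)
      then obtain N where "M dvd (\<Sum>j<N. fst (r k) i j * x j) - snd (r k) i"
          "M dvd (\<Sum>j<N. fst (r k) i j * x j) - dot (fst (r k) i) (\<sigma> l)"
        by (metis (no_types, lifting) eventually_sequentially order_refl)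
      from dvd_diff[OF this] M(2)[of l] l(1) show False by simp
    qed
    then show "case p of (\<psi>, g) \<Rightarrow> \<not> (\<forall>k. dot_lim (\<psi> k) x (g k))"
      unfolding k by (auto split: prod.split)
  qed
qed


lemma bs_S_subset_bs_D: "bs_S \<subseteq> bs_D"
proof
  fix s assume "s \<in> bs_S"
  then have "\<forall>\<^sub>F i in sequentially. s i = 0"
    by (simp add: bs_S_iff eventually_sequentially)
  then show "s \<in> bs_D"
    unfolding bs_D_iff by (auto elim: eventually_mono)
qed

text \<open>Dual to the previous construction: now the elements are given and the functional a is
  generic. Smallness comes from D instead of factorials: entries of y are eventually divisible by M,
  and increments vanish on any prescribed initial segment from some level on. Taking every pair (y,
  z) with z an integer as a target excludes all integral values at y.\<close>

lemma exists_integral_not_integral: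
  assumes X: "countable X" "range unit_seq \<subseteq> X" "X \<subseteq> bs_D"
    and Y: "countable Y" "Y \<noteq> {}" "Y \<subseteq> bs_D"
    and indep: "\<And>y F c v. y \<in> Y \<Longrightarrow> finite F \<Longrightarrow> F \<subseteq> X \<Longrightarrow> c \<noteq> 0 \<Longrightarrow>
      \<exists>i. c * y i \<noteq> (\<Sum>g\<in>F. v g * g i)"
  shows "\<exists>a. (\<forall>g\<in>X. integral_at a g) \<and> (\<forall>y\<in>Y. \<not> integral_at a y)"
proof -
  define g where "g = from_nat_into X"
  define r where "r = from_nat_into (Y \<times> (UNIV :: int set))"
  have ran: "range g = X" "range r = Y \<times> UNIV"
    using X Y by (auto simp: g_def r_def intro!: range_from_nat_into)
  have r_Y: "fst (r k) \<in> Y" for k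
    using ran(2) by (metis SigmaE fst_conv rangeI)
  have g_unit: "\<exists>j. g j = unit_seq i" for i
    using X(2) ran(1) by (metis rangeE range_subsetD)
  define T where "T m = {b \<in> bs_S. \<forall>j<m. dot (g j) b = 0}" for m
  have "\<exists>\<sigma>. (\<forall>l. \<sigma> l \<in> T 0) \<and> (\<forall>k l. k \<le> l \<longrightarrow> \<sigma> l - \<sigma> k \<in> T k) \<and>
    (\<forall>k. \<exists>M\<noteq>0. \<exists>i::unit. \<forall>l>k. \<not> M dvd dot (fst (r k)) (\<sigma> l) - snd (r k))"
  proof (rule avoid_targets)
    show "0 \<in> T m" for m by (simp add: T_def)
    show "s + t \<in> T m" if "s \<in> T m" "t \<in> T m" for s t m
      using that by (auto simp: T_def bs_S_add dot_add)
    show "T n \<subseteq> T m" if "m \<le> n" for m n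
      using that by (auto simp: T_def)
    show "dot (fst (r k)) (s + t) = dot (fst (r k)) s + dot (fst (r k)) t"
      if "s \<in> T 0" "t \<in> T 0" for k s t
      using that by (simp add: T_def dot_add)
    show "\<exists>t\<in>T m. \<exists>i. dot (fst (r k)) t \<noteq> 0" for k m
    proof (rule ccontr)
      \<comment> \<open>Otherwise y, as a functional, vanishes on the joint kernel of the first m
        elements of X, so a nonzero multiple of it factors through them; evaluation at unit
        sequences contradicts \<open>indep\<close>.\<close>
      assume "\<not> (\<exists>t\<in>T m. \<exists>i. dot (fst (r k)) t \<noteq> 0)"
      then have *: "dot (fst (r k)) t = 0" if "t \<in> bs_S" "\<forall>a\<in>g ` {..<m}. dot a t = 0" for t
        using that by (auto simp: T_def)
      have "\<exists>c v. c \<noteq> 0 \<and> (\<forall>s\<in>bs_S. \<forall>_::unit. c * dot (fst (r k)) s = (\<Sum>a\<in>g ` {..<m}. dot a s * v a ()))"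
        using factor_through_functionals[of "g ` {..<m}" bs_S "\<lambda>_::unit. fst (r k)"] * bs_S_lincomb
        by force
      then obtain c v where c: "c \<noteq> 0"
        "\<And>s. s \<in> bs_S \<Longrightarrow> c * dot (fst (r k)) s = (\<Sum>a\<in>g ` {..<m}. dot a s * v a ())" by blast
      have "c * fst (r k) i = (\<Sum>a\<in>g ` {..<m}. v a () * a i)" for i
        using c(2)[of "unit_seq i"] by (simp add: mult.commute)
      moreover have "g ` {..<m} \<subseteq> X" using ran(1) by auto
      ultimately show False using indep[OF r_Y, of "g ` {..<m}" c k "\<lambda>a. v a ()"] c(1) by auto
    qed
    show "\<exists>m. \<forall>t\<in>T m. \<forall>i. M dvd dot (fst (r k)) t" if M: "M \<noteq> 0" for k and M :: int
    proof -
      obtain N where N: "\<And>i. i \<ge> N \<Longrightarrow> M dvd fst (r k) i"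
        using subsetD[OF Y(3) r_Y[of k]] M unfolding bs_D_iff eventually_sequentially by blast
      obtain h where h: "\<And>i. g (h i) = unit_seq i" using g_unit by metis
      \<comment> \<open>This level lies beyond the positions at which the unit sequences with index
        below N are listed; so t is zero wherever the entry of y may fail to be divisible by
        M.\<close>
      have "M dvd dot (fst (r k)) t" if t: "t \<in> T (Suc (Max (h ` {..N})))" for t
      proof -
        have "t i = 0" if "i < N" for i
        proof -
          have "h i \<le> Max (h ` {..N})" using that by (intro Max_ge) auto
          then have "dot (g (h i)) t = 0" using t by (simp add: T_def)
          then show ?thesis using t by (simp add: h T_def)
        qed
        then have "M dvd fst (r k) i * t i" for i
          by (cases "i < N") (use N in auto)
        then show ?thesis unfolding dot_def by (intro dvd_sum) simp
      qed
      then show ?thesis by blast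
    qed
  qed
  then obtain \<sigma> where "\<forall>l. \<sigma> l \<in> T 0" and \<sigma>: "\<And>k l. k \<le> l \<Longrightarrow> \<sigma> l - \<sigma> k \<in> T k"
    and avoid: "\<And>k. \<exists>M\<noteq>0. \<forall>l>k. \<not> M dvd dot (fst (r k)) (\<sigma> l) - snd (r k)"
    by (elim exE conjE) simp
  then have \<sigma>0: "\<sigma> l \<in> bs_S" for l by (simp add: T_def)
  have stable: "dot (g j) (\<sigma> l) = dot (g j) (\<sigma> (Suc j))" if "Suc j \<le> l" for j l
    using \<sigma>[OF that] \<sigma>0 by (simp add: T_def dot_diff)
  define a where "a i = \<sigma> (Suc (SOME j. g j = unit_seq i)) i" for i
  have a_eq: "\<forall>\<^sub>F l in sequentially. \<sigma> l i = a i" for i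
  proof -
    define j where "j = (SOME j. g j = unit_seq i)"
    have gj: "g j = unit_seq i" using g_unit[of i] unfolding j_def by (rule someI_ex)
    have "\<sigma> l i = a i" if "Suc j \<le> l" for l
      using stable[OF that] \<sigma>0 by (simp add: gj a_def flip: j_def)
    then show ?thesis unfolding eventually_sequentially by blast
  qed
  \<comment> \<open>Here \<open>\<sigma> l\<close> agrees with a on an initial segment only; beyond
    it the entries of y are divisible by M, so disagreement does no harm.\<close>
  have approx: "\<forall>\<^sub>F l in sequentially. \<forall>\<^sub>F N in sequentially. M dvd (\<Sum>i<N. a i * y i) - dot y (\<sigma> l)"
    if y: "y \<in> bs_D" and M: "M \<noteq> 0" for y M
  proof -
    obtain N0 where N0: "\<And>i. i \<ge> N0 \<Longrightarrow> M dvd y i"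
      using y M unfolding bs_D_iff eventually_sequentially by blast
    have "\<forall>\<^sub>F l in sequentially. \<forall>i\<in>{..<N0}. \<sigma> l i = a i"
      using a_eq by (intro eventually_ball_finite) auto
    then show ?thesis
    proof eventually_elim
      case (elim l)
      obtain N1 where N1: "\<And>i. i \<ge> N1 \<Longrightarrow> \<sigma> l i = 0" using \<sigma>0[of l] bs_S_iff by blast
      have "M dvd (\<Sum>i<N. a i * y i) - dot y (\<sigma> l)" if "N \<ge> N1" for N
      proof -
        have "M dvd a i * y i - y i * \<sigma> l i" for i
          by (cases "i < N0") (use elim N0 in auto)
        then have "M dvd (\<Sum>i<N. a i * y i) - (\<Sum>i<N. y i * \<sigma> l i)"
          by (intro sum_cong_dvd)
        then show ?thesis using dot_eq_sum[of N "\<sigma> l" y] N1 that by simp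
      qed
      then show ?case unfolding eventually_sequentially by blast
    qed
  qed
  show ?thesis
  proof (intro exI[of _ a] conjI ballI)
    fix x assume "x \<in> X"
    then obtain j where j: "x = g j" using ran(1) by blast
    have "dot_lim a x (dot x (\<sigma> (Suc j)))"
      unfolding dot_lim_def
    proof (intro allI impI)
      fix M :: int assume "M \<noteq> 0"
      then have "\<forall>\<^sub>F l in sequentially. l \<ge> Suc j \<and> (\<forall>\<^sub>F N in sequentially. M dvd (\<Sum>i<N. a i * x i) - dot x (\<sigma> l))"
        using approx[of x M] \<open>x \<in> X\<close> X(3) by (intro eventually_conj eventually_ge_at_top) auto
      from eventually_happens'[OF sequentially_bot this] obtain l where l: "l \<ge> Suc j"
        "\<forall>\<^sub>F N in sequentially. M dvd (\<Sum>i<N. a i * x i) - dot x (\<sigma> l)" by blast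
      then show "\<forall>\<^sub>F N in sequentially. M dvd (\<Sum>i<N. a i * x i) - dot x (\<sigma> (Suc j))"
        using stable[OF l(1)] j by simp
    qed
    then show "integral_at a x" by blast
  next
    fix y assume y: "y \<in> Y"
    show "\<not> integral_at a y"
    proof
      assume "integral_at a y"
      then obtain z where z: "dot_lim a y z" by blast
      obtain k where k: "r k = (y, z)" using ran(2) y by (metis SigmaI UNIV_I rangeE)
      obtain M where M: "M \<noteq> 0" "\<And>l. l > k \<Longrightarrow> \<not> M dvd dot y (\<sigma> l) - z"
        using avoid[of k] k by auto
      have "\<forall>\<^sub>F l in sequentially. l > k \<and> (\<forall>\<^sub>F N in sequentially. M dvd (\<Sum>i<N. a i * y i) - dot y (\<sigma> l))"
        using approx[of y M] y Y(3) M(1) by (intro eventually_conj eventually_gt_at_top) auto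
      from eventually_happens'[OF sequentially_bot this] obtain l where l: "l > k"
        "\<forall>\<^sub>F N in sequentially. M dvd (\<Sum>i<N. a i * y i) - dot y (\<sigma> l)" by blast
      have "\<forall>\<^sub>F N in sequentially. M dvd (\<Sum>i<N. a i * y i) - z"
        using z M(1) by (simp add: dot_lim_def)
      with l(2) have "\<forall>\<^sub>F N in sequentially. M dvd dot y (\<sigma> l) - z"
      proof eventually_elim
        case (elim N)
        from dvd_diff[OF elim(2,1)] show ?case by simp
      qed
      then show False using M(2)[OF l(1)] by simp
    qed
  qed
qed

section \<open>Integer spans and one stage of the recursion\<close>

definition int_span :: "(nat \<Rightarrow> int) set \<Rightarrow> (nat \<Rightarrow> int) set" where
  "int_span X = {\<lambda>i. \<Sum>g\<in>F. v g * g i | F v. finite F \<and> F \<subseteq> X}"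

text \<open>A linear combination is coded by a finite set of pairs of a vector and its
  coefficient.\<close>

lemma countable_int_span:
  assumes "countable X"
  shows "countable (int_span X)"
proof -
  let ?E = "{E. finite E \<and> E \<subseteq> X \<times> (UNIV :: int set)}"
  have "int_span X \<subseteq> (\<lambda>E i. \<Sum>(g, c)\<in>E. c * g i) ` ?E"
  proof
    fix x assume "x \<in> int_span X"
    then obtain F v where F: "finite F" "F \<subseteq> X" "x = (\<lambda>i. \<Sum>g\<in>F. v g * g i)"
      by (auto simp: int_span_def)
    have "inj_on (\<lambda>g. (g, v g)) F" by (auto intro: inj_onI)
    then have "x = (\<lambda>i. \<Sum>(g, c)\<in>(\<lambda>g. (g, v g)) ` F. c * g i)"
      by (simp add: F(3) sum.reindex)
    then show "x \<in> (\<lambda>E i. \<Sum>(g, c)\<in>E. c * g i) ` ?E"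
      using F by (intro image_eqI[of _ _ "(\<lambda>g. (g, v g)) ` F"]) auto
  qed
  moreover have "countable ((\<lambda>E i. \<Sum>(g, c)\<in>E. c * g i) ` ?E)"
    using assms by (intro countable_image countable_Collect_finite_subset countable_SIGMA) auto
  ultimately show ?thesis by (rule countable_subset)
qed

lemma zero_in_int_span: "(\<lambda>_. 0) \<in> int_span X"
  unfolding int_span_def by (force intro: exI[of _ "{}"])

lemma int_span_insertE:
  assumes "y \<in> int_span (insert x X)"
  obtains n g where "g \<in> int_span X" "\<And>i. y i = n * x i + g i"
proof -
  obtain F v where F: "finite F" "F \<subseteq> insert x X" "y = (\<lambda>i. \<Sum>g\<in>F. v g * g i)"
    using assms by (auto simp: int_span_def)
  define g where "g = (\<lambda>i. \<Sum>g\<in>F - {x}. v g * g i)"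
  have "g \<in> int_span X" unfolding int_span_def g_def using F by blast
  moreover have "y i = (if x \<in> F then v x else 0) * x i + g i" for i
    using F by (auto simp: g_def sum.remove)
  ultimately show ?thesis using that by blast
qed

text \<open>\<open>\<Phi>\<close> encodes the additive map on \<open>S\<close> that sends the \<open>i\<close>-th unit sequence to \<open>\<lambda>k. \<Phi> k i\<close>.\<close>

definition almost_scalar_mod :: "(nat \<Rightarrow> int) set \<Rightarrow> (nat \<Rightarrow> nat \<Rightarrow> int) \<Rightarrow> bool" where
  "almost_scalar_mod A \<Phi> \<longleftrightarrow> (\<exists>m n F. m \<noteq> 0 \<and> finite F \<and> F \<subseteq> A \<and>
     (\<forall>t\<in>bs_S. (\<forall>a\<in>F. dot a t = 0) \<longrightarrow> (\<forall>k. dot (\<lambda>i. m * \<Phi> k i + n * unit_seq k i) t = 0)))"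

text \<open>X and A are the choices made so far. Outside the exceptional case, x is chosen so that
  \<open>m \<Phi>(x) + n x\<close> with m nonzero is never in the span of X and the unit sequences.
  Then no nonzero multiple of \<open>\<Phi>(x)\<close> lies in the span of these together with x,
  and a functional integral on that span can be made non-integral at
  \<open>\<Phi>(x)\<close>.\<close>

lemma extension_step:
  fixes \<Phi> :: "nat \<Rightarrow> nat \<Rightarrow> int"
  assumes X: "countable X" "X \<subseteq> bs_D" and A: "countable A"
  shows "\<exists>x a. x \<in> bs_D \<and> (\<forall>b\<in>A \<union> range unit_seq. integral_at b x) \<and>
    (\<forall>g\<in>insert x X. integral_at a g) \<and> a \<notin> A \<and>
    (almost_scalar_mod (A \<union> range unit_seq) \<Phi> \<or>
      (\<forall>y\<in>bs_D. (\<forall>k. dot_lim (\<Phi> k) x (y k)) \<longrightarrow> \<not> integral_at a y))"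
proof -
  define A' where "A' = A \<union> range unit_seq"
  define X' where "X' = X \<union> range unit_seq"
  have A': "countable A'" "range unit_seq \<subseteq> A'" using A by (auto simp: A'_def)
  have unit_D: "unit_seq i \<in> bs_D" for i
    using bs_S_subset_bs_D by auto
  have X': "countable X'" "range unit_seq \<subseteq> X'" "X' \<subseteq> bs_D"
    using X unit_D by (auto simp: X'_def)
  obtain x where x: "x \<in> bs_D" "\<forall>b\<in>A'. integral_at b x"
    and avoid: "\<And>m n g. \<not> almost_scalar_mod A' \<Phi> \<Longrightarrow> m \<noteq> 0 \<Longrightarrow>
      g \<in> int_span X' \<Longrightarrow> \<not> (\<forall>k. dot_lim (\<lambda>i. m * \<Phi> k i + n * unit_seq k i) x (g k))"
  proof (cases "almost_scalar_mod A' \<Phi>")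
    case True
    \<comment> \<open>In the exceptional case there is nothing to avoid, and x = 0 serves.\<close>
    have "(\<lambda>_. 0) \<in> bs_D" by (simp add: bs_D_iff)
    moreover have "integral_at b (\<lambda>_. 0)" for b by (auto simp: dot_lim_def intro: exI[of _ 0])
    ultimately show ?thesis using True that by blast
  next
    case False
    \<comment> \<open>One target for each forbidden equation \<open>m \<Phi>(x) + n x = g\<close>.
      That these functionals do not all vanish on a finite joint kernel is the negation of
      \<open>almost_scalar_mod\<close>.\<close>
    define R where "R = (\<lambda>(m, n, g). (\<lambda>k i. m * \<Phi> k i + n * unit_seq k i, g)) ` ((UNIV - {0}) \<times> UNIV \<times> int_span X')"
    have "countable R"
      unfolding R_def using countable_int_span[OF X'(1)] by (intro countable_image countable_SIGMA) auto
    moreover have "(1::int, 0::int, \<lambda>_. 0) \<in> (UNIV - {0}) \<times> UNIV \<times> int_span X'"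
      using zero_in_int_span by auto
    then have "R \<noteq> {}" unfolding R_def by blast
    moreover have "\<exists>t\<in>bs_S. (\<forall>a\<in>F. dot a t = 0) \<and> (\<exists>k. dot (\<psi> k) t \<noteq> 0)"
      if \<psi>: "(\<psi>, g) \<in> R" and F: "finite F" "F \<subseteq> A'" for \<psi> g F
    proof -
      obtain m n where "m \<noteq> 0" "\<psi> = (\<lambda>k i. m * \<Phi> k i + n * unit_seq k i)"
        using \<psi> by (auto simp: R_def)
      then show ?thesis using False F unfolding almost_scalar_mod_def by blast
    qed
    ultimately obtain x where x: "x \<in> bs_D" "\<forall>a\<in>A'. integral_at a x"
      "\<forall>(\<psi>, g)\<in>R. \<not> (\<forall>k. dot_lim (\<psi> k) x (g k))"
      using exists_integral_avoiding[OF A', of R] by blast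
    show ?thesis
    proof (rule that[OF x(1,2)])
      fix m n :: int and g assume "m \<noteq> 0" "g \<in> int_span X'"
      then have "(\<lambda>k i. m * \<Phi> k i + n * unit_seq k i, g) \<in> R"
        unfolding R_def by (intro image_eqI[of _ _ "(m, n, g)"]) auto
      then show "\<not> (\<forall>k. dot_lim (\<lambda>i. m * \<Phi> k i + n * unit_seq k i) x (g k))"
        using bspec[OF x(3)] by fastforce
    qed
  qed
  let ?X = "insert x X'"
  have X'': "countable ?X" "range unit_seq \<subseteq> ?X" "?X \<subseteq> bs_D" using X' x by auto
  \<comment> \<open>Every element of \<open>A\<close> is integral at \<open>w\<close> but \<open>a\<close> will not be, which ensures \<open>a \<notin> A\<close>.\<close>
  obtain w where w: "w \<in> bs_D" "\<forall>b\<in>A'. integral_at b w"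
    and w_avoid: "\<And>c g. c \<noteq> 0 \<Longrightarrow> g \<in> int_span ?X \<Longrightarrow>
       \<exists>k. c * w k \<noteq> g k"
  proof -
    define R where "R = (\<lambda>(c, g). (\<lambda>k i. c * unit_seq k i, g)) ` ((UNIV - {0}) \<times> int_span ?X)"
    have "countable R"
      unfolding R_def using countable_int_span[OF X''(1)] by (intro countable_image countable_SIGMA) auto
    moreover have "(1::int, \<lambda>_. 0) \<in> (UNIV - {0}) \<times> int_span ?X"
      using zero_in_int_span by auto
    then have "R \<noteq> {}" unfolding R_def by blast
    moreover have "\<exists>t\<in>bs_S. (\<forall>a\<in>F. dot a t = 0) \<and> (\<exists>k. dot (\<psi> k) t \<noteq> 0)"
      if \<psi>: "(\<psi>, g) \<in> R" and F: "finite F" "F \<subseteq> A'" for \<psi> g F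
    proof -
      obtain c where c: "c \<noteq> 0" "\<psi> = (\<lambda>k i. c * unit_seq k i)"
        using \<psi> by (auto simp: R_def)
      obtain t k where t: "t \<in> bs_S" "\<forall>a\<in>F. dot a t = 0" "t k \<noteq> 0"
        using exists_nonzero_in_joint_kernel[OF F(1)] by blast
      have "dot (\<psi> k) t = c * t k"
        using dot_lincomb_left[of c "unit_seq k" 0 "unit_seq k" t] t(1) c(2) by simp
      then have "dot (\<psi> k) t \<noteq> 0" using t(3) c(1) by simp
      then show ?thesis using t(1,2) by blast
    qed
    ultimately obtain w where w: "w \<in> bs_D" "\<forall>a\<in>A'. integral_at a w"
      "\<forall>(\<psi>, g)\<in>R. \<not> (\<forall>k. dot_lim (\<psi> k) w (g k))"
      using exists_integral_avoiding[OF A', of R] by blast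
    show ?thesis
    proof (rule that[OF w(1,2)])
      fix c :: int and g assume c: "c \<noteq> 0" "g \<in> int_span ?X"
      then have "(\<lambda>k i. c * unit_seq k i, g) \<in> R"
        unfolding R_def by (intro image_eqI[of _ _ "(c, g)"]) auto
      then obtain k where k: "\<not> dot_lim (\<lambda>i. c * unit_seq k i) w (g k)"
        using bspec[OF w(3)] by fastforce
      moreover have "dot_lim (\<lambda>i. c * unit_seq k i) w (c * w k)"
        using dot_lim_lincomb_left[OF dot_lim_unit_left[of k w] dot_lim_unit_left[of k w], of c 0] by simp
      ultimately show "\<exists>k. c * w k \<noteq> g k" by metis
    qed
  qed
  \<comment> \<open>By uniqueness of limits the second set has at most one element, namely
    \<open>\<Phi>(x)\<close>; in the exceptional case it is empty and only w remains.\<close>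
  define Y where "Y = insert w {y \<in> bs_D. \<not> almost_scalar_mod A' \<Phi> \<and> (\<forall>k. dot_lim (\<Phi> k) x (y k))}"
  have "countable Y"
  proof -
    have "{y \<in> bs_D. \<not> almost_scalar_mod A' \<Phi> \<and> (\<forall>k. dot_lim (\<Phi> k) x (y k))} \<subseteq> {\<lambda>k. THE z. dot_lim (\<Phi> k) x z}"
    proof
      fix y assume "y \<in> {y \<in> bs_D. \<not> almost_scalar_mod A' \<Phi> \<and> (\<forall>k. dot_lim (\<Phi> k) x (y k))}"
      then have y: "dot_lim (\<Phi> k) x (y k)" for k by blast
      then have "(THE z. dot_lim (\<Phi> k) x z) = y k" for k
        by (rule the_equality) (rule dot_lim_unique[OF _ y])
      then show "y \<in> {\<lambda>k. THE z. dot_lim (\<Phi> k) x z}" by simp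
    qed
    from countable_subset[OF this] show ?thesis unfolding Y_def by simp
  qed
  moreover have "\<exists>i. c * y i \<noteq> (\<Sum>g\<in>F. v g * g i)" if "y \<in> Y" "finite F" "F \<subseteq> ?X" "c \<noteq> 0" for y F c v
  proof (rule ccontr)
    assume "\<not> ?thesis"
    then have eq: "c * y i = (\<Sum>g\<in>F. v g * g i)" for i by simp
    have span: "(\<lambda>i. c * y i) \<in> int_span ?X" unfolding int_span_def eq using that(2,3) by blast
    show False
    proof (cases "y = w")
      case True
      then show ?thesis using w_avoid[OF \<open>c \<noteq> 0\<close> span] by simp
    next
      case False
      then have y: "\<not> almost_scalar_mod A' \<Phi>" "\<And>k. dot_lim (\<Phi> k) x (y k)" using \<open>y \<in> Y\<close> by (auto simp: Y_def)
      obtain n g where g: "g \<in> int_span X'" "\<And>i. c * y i = n * x i + g i"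
        using int_span_insertE[OF span] by blast
      \<comment> \<open>The relation \<open>c y = n x + g\<close> becomes
        \<open>c \<Phi>(x) - n x = g\<close>, one of the equations avoided by x.\<close>
      have "dot_lim (\<lambda>i. c * \<Phi> k i + (-n) * unit_seq k i) x (c * y k + (-n) * x k)" for k
        by (intro dot_lim_lincomb_left y dot_lim_unit_left)
      moreover have "c * y k + (-n) * x k = g k" for k using g(2)[of k] by simp
      ultimately show ?thesis using avoid[OF y(1) \<open>c \<noteq> 0\<close> g(1), of "-n"] by auto
    qed
  qed
  ultimately obtain a where a: "\<forall>g\<in>?X. integral_at a g" "\<forall>y\<in>Y. \<not> integral_at a y"
    using exists_integral_not_integral[OF X'', of Y] w(1) unfolding Y_def by blast
  have "a \<notin> A" using a(2) w(2) by (auto simp: Y_def A'_def)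
  moreover have "\<forall>g\<in>insert x X. integral_at a g" using a(1) by (auto simp: X'_def)
  moreover have "almost_scalar_mod A' \<Phi> \<or> (\<forall>y\<in>bs_D. (\<forall>k. dot_lim (\<Phi> k) x (y k)) \<longrightarrow> \<not> integral_at a y)"
    using a(2) by (auto simp: Y_def)
  ultimately show ?thesis using x unfolding A'_def by blast
qed

subsection \<open>The transfinite recursion\<close>

text \<open>Under the continuum hypothesis a type of size at most the continuum embeds into the
  first uncountable cardinal. The strict order pulled back along the embedding has countable initial
  segments.\<close>

lemma continuum_hypothesis_wf_total_countable:
  assumes "continuum_hypothesis" and h: "inj (h :: 'a \<Rightarrow> nat \<Rightarrow> bool)"
  shows "\<exists>R :: ('a \<times> 'a) set. wf R \<and> (\<forall>x y. x \<noteq> y \<longrightarrow> (x, y) \<in> R \<or> (y, x) \<in> R) \<and>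
    (\<forall>y. countable {x. (x, y) \<in> R})"
proof -
  let ?r = "cardSuc natLeq"
  have r: "Card_order ?r" by (rule cardSuc_Card_order[OF natLeq_Card_order])
  have "|UNIV :: 'a set| \<le>o |UNIV :: (nat \<Rightarrow> bool) set|"
    using h card_of_ordLeq[of UNIV UNIV] by blast
  also have "|UNIV :: (nat \<Rightarrow> bool) set| =o ctwo ^c natLeq"
    by (simp add: cexp_def ctwo_def Field_natLeq Field_card_of Func_def card_of_refl)
  also have "ctwo ^c natLeq =o ?r"
    using assms(1) by (simp add: continuum_hypothesis_def)
  also have "?r =o |Field ?r|"
    by (rule ordIso_symmetric[OF card_of_Field_ordIso[OF r]])
  finally obtain e :: "'a \<Rightarrow> _" where e: "inj e" "range e \<subseteq> Field ?r"
    unfolding card_of_ordLeq[symmetric] by blast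
  have wo: "Well_order ?r" using r by (rule Card_order_wo_rel[unfolded wo_rel_def])
  define R where "R = inv_image (?r - Id) e"
  have "wf R" using wo unfolding R_def by (intro wf_inv_image) (simp add: well_order_on_def)
  moreover have "(x, y) \<in> R \<or> (y, x) \<in> R" if "x \<noteq> y" for x y
  proof -
    have "e x \<noteq> e y" "e x \<in> Field ?r" "e y \<in> Field ?r" using that e by (auto dest: injD)
    then have "(e x, e y) \<in> ?r \<or> (e y, e x) \<in> ?r"
      using wo by (auto simp: well_order_on_def linear_order_on_def total_on_def)
    then show ?thesis using \<open>e x \<noteq> e y\<close> by (auto simp: R_def)
  qed
  moreover have "countable {x. (x, y) \<in> R}" for y
  proof -
    have "|underS ?r (e y)| <o ?r" using card_of_underS[OF r] e(2) by blast
    then have "|underS ?r (e y)| \<le>o natLeq"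
      by (simp add: cardSuc_ordLeq_ordLess[OF natLeq_Card_order card_of_Card_order])
    then have "countable (underS ?r (e y))" by (simp add: countable_card_le_natLeq)
    moreover have "e ` {x. (x, y) \<in> R} \<subseteq> underS ?r (e y)"
      by (auto simp: R_def underS_def)
    ultimately have "countable (e ` {x. (x, y) \<in> R})" by (rule countable_subset[rotated])
    then show ?thesis by (rule countable_image_inj_on) (use e(1) in \<open>auto simp: inj_on_def\<close>)
  qed
  ultimately show ?thesis by blast
qed

text \<open>A function is coded by the set of codes of the points of its graph; this bounds the
  number of such functions by the continuum.\<close>

lemma inj_graph_code:
  "inj (\<lambda>(\<Phi> :: 'a::countable \<Rightarrow> 'b::countable) n. \<exists>i. n = to_nat (i, \<Phi> i))"
proof (rule injI)
  fix \<Phi> \<Psi> :: "'a \<Rightarrow> 'b"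
  assume eq: "(\<lambda>n. \<exists>i. n = to_nat (i, \<Phi> i)) = (\<lambda>n. \<exists>i. n = to_nat (i, \<Psi> i))"
  show "\<Phi> = \<Psi>"
  proof
    fix i
    have "\<exists>j. to_nat (i, \<Phi> i) = to_nat (j, \<Psi> j)" using fun_cong[OF eq, of "to_nat (i, \<Phi> i)"] by auto
    then show "\<Phi> i = \<Psi> i" by simp
  qed
qed

lemma uncountable_fun_UNIV: "uncountable (UNIV :: (nat \<Rightarrow> 'a \<Rightarrow> int) set)"
proof
  assume "countable (UNIV :: (nat \<Rightarrow> 'a \<Rightarrow> int) set)"
  then obtain e :: "nat \<Rightarrow> nat \<Rightarrow> 'a \<Rightarrow> int" where e: "range e = UNIV"
    by (metis UNIV_not_empty range_from_nat_into)
  define f where "f n x = e n n x + 1" for n x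
  obtain n where "f = e n" using e by (metis UNIV_I rangeE)
  then have "e n n x = e n n x + 1" for x unfolding f_def by metis
  then show False by simp
qed

lemma almost_scalar_mod_mono:
  "almost_scalar_mod A \<Phi> \<Longrightarrow> A \<subseteq> B \<Longrightarrow> almost_scalar_mod B \<Phi>"
  unfolding almost_scalar_mod_def by (meson subset_trans)

text \<open>Well-founded recursion on \<open>\<Phi>\<close>; countable initial segments keep the
  earlier choices countable, as \<open>extension_step\<close> requires. Of two distinct indices, the
  later stage secures integrality in both directions and the distinctness of the
  functionals.\<close>

lemma exists_orthogonal_family:
  assumes "continuum_hypothesis"
  shows "\<exists>(x :: (nat \<Rightarrow> nat \<Rightarrow> int) \<Rightarrow> nat \<Rightarrow> int) a. inj a \<and> (\<forall>\<Phi>. x \<Phi> \<in> bs_D) \<and>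
    (\<forall>\<Phi> \<Psi>. integral_at (a \<Phi>) (x \<Psi>)) \<and>
    (\<forall>\<Phi>. almost_scalar_mod (range a \<union> range unit_seq) \<Phi> \<or>
      (\<forall>y\<in>bs_D. (\<forall>k. dot_lim (\<Phi> k) (x \<Phi>) (y k)) \<longrightarrow> \<not> integral_at (a \<Phi>) y))"
proof -
  \<comment> \<open>Uncurrying yields countable domain and codomain, so that
    \<open>inj_graph_code\<close> applies.\<close>
  define c where "c = (\<lambda>(\<Phi> :: nat \<Rightarrow> nat \<Rightarrow> int) (p :: nat \<times> nat). \<Phi> (fst p) (snd p))"
  have "inj c" by (rule injI) (auto simp: c_def fun_eq_iff)
  note wf_total = continuum_hypothesis_wf_total_countable[OF assms inj_compose[OF inj_graph_code this]]
  from wf_total obtain R :: "((nat \<Rightarrow> nat \<Rightarrow> int) \<times> (nat \<Rightarrow> nat \<Rightarrow> int)) set"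
    where R: "wf R" "\<And>x y. x \<noteq> y \<Longrightarrow> (x, y) \<in> R \<or> (y, x) \<in> R" "\<And>y. countable {x. (x, y) \<in> R}"
    by blast
  define Q where "Q X A \<Phi> p \<longleftrightarrow> fst p \<in> bs_D \<and> (\<forall>b\<in>A \<union> range unit_seq. integral_at b (fst p)) \<and>
      (\<forall>g\<in>insert (fst p) X. integral_at (snd p) g) \<and> snd p \<notin> A \<and>
      (almost_scalar_mod (A \<union> range unit_seq) \<Phi> \<or>
      (\<forall>y\<in>bs_D. (\<forall>k. dot_lim (\<Phi> k) (fst p) (y k)) \<longrightarrow> \<not> integral_at (snd p) y))"
    for X A \<Phi> p
  define P where "P f \<Phi> p \<longleftrightarrow> Q ((fst \<circ> f) ` {\<Psi>. (\<Psi>, \<Phi>) \<in> R}) ((snd \<circ> f) ` {\<Psi>. (\<Psi>, \<Phi>) \<in> R}) \<Phi> p"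
    for f \<Phi> p
  have "\<exists>f. \<forall>\<Phi>. P f \<Phi> (f \<Phi>)"
  proof (rule dependent_wf_choice[OF R(1)])
    show "P f \<Phi> p = P g \<Phi> p" if "\<And>\<Psi>. (\<Psi>, \<Phi>) \<in> R \<Longrightarrow> f \<Psi> = g \<Psi>" for f g \<Phi> p
    proof -
      have "(q \<circ> f) ` {\<Psi>. (\<Psi>, \<Phi>) \<in> R} = (q \<circ> g) ` {\<Psi>. (\<Psi>, \<Phi>) \<in> R}" for q :: "_ \<Rightarrow> nat \<Rightarrow> int"
        using that by (intro image_cong) auto
      then show ?thesis unfolding P_def by (simp only:)
    qed
    show "\<exists>p. P f \<Phi> p" if IH: "\<And>\<Psi>. (\<Psi>, \<Phi>) \<in> R \<Longrightarrow> P f \<Psi> (f \<Psi>)" for f \<Phi>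
    proof -
      let ?X = "(fst \<circ> f) ` {\<Psi>. (\<Psi>, \<Phi>) \<in> R}" and ?A = "(snd \<circ> f) ` {\<Psi>. (\<Psi>, \<Phi>) \<in> R}"
      have "?X \<subseteq> bs_D" using IH unfolding P_def Q_def by auto
      moreover have "countable ?X" "countable ?A" using R(3) by (intro countable_image; simp)+
      ultimately obtain x a where "Q ?X ?A \<Phi> (x, a)"
        using extension_step[of ?X ?A \<Phi>] unfolding Q_def fst_conv snd_conv by blast
      then show ?thesis unfolding P_def by blast
    qed
  qed
  then obtain f where f: "\<And>\<Phi>. P f \<Phi> (f \<Phi>)" by blast
  define x where "x = fst \<circ> f"
  define a where "a = snd \<circ> f"
  have x_D: "x \<Phi> \<in> bs_D" for \<Phi> using f[of \<Phi>] by (simp add: P_def Q_def x_def)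
  have diag: "integral_at (a \<Phi>) (x \<Phi>)" for \<Phi> using f[of \<Phi>] by (simp add: P_def Q_def x_def a_def)
  have less: "integral_at (a \<Psi>) (x \<Phi>)" "integral_at (a \<Phi>) (x \<Psi>)" "a \<Phi> \<noteq> a \<Psi>" if "(\<Psi>, \<Phi>) \<in> R" for \<Phi> \<Psi>
    using f[of \<Phi>] that by (auto simp: P_def Q_def x_def a_def)
  have "integral_at (a \<Phi>) (x \<Psi>)" for \<Phi> \<Psi>
    using R(2)[of \<Phi> \<Psi>] diag less by (cases "\<Phi> = \<Psi>") auto
  moreover have "inj a" using R(2) less(3) by (metis injI)
  moreover have "almost_scalar_mod (range a \<union> range unit_seq) \<Phi> \<or>
      (\<forall>y\<in>bs_D. (\<forall>k. dot_lim (\<Phi> k) (x \<Phi>) (y k)) \<longrightarrow> \<not> integral_at (a \<Phi>) y)" for \<Phi>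
  proof -
    have "almost_scalar_mod (a ` {\<Psi>. (\<Psi>, \<Phi>) \<in> R} \<union> range unit_seq) \<Phi> \<or>
        (\<forall>y\<in>bs_D. (\<forall>k. dot_lim (\<Phi> k) (x \<Phi>) (y k)) \<longrightarrow> \<not> integral_at (a \<Phi>) y)"
      using f[of \<Phi>] by (simp add: P_def Q_def x_def a_def)
    moreover have "a ` {\<Psi>. (\<Psi>, \<Phi>) \<in> R} \<union> range unit_seq \<subseteq> range a \<union> range unit_seq" by auto
    ultimately show ?thesis using almost_scalar_mod_mono by blast
  qed
  ultimately show ?thesis using x_D by blast
qed

subsection \<open>Rank\<close>

lemma int_span_finite:
  assumes "finite X" "x \<in> int_span X"
  obtains v where "x = (\<lambda>i. \<Sum>g\<in>X. v g * g i)"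
proof -
  obtain F v where F: "F \<subseteq> X" "x = (\<lambda>i. \<Sum>g\<in>F. v g * g i)"
    using assms(2) by (auto simp: int_span_def)
  have "(\<Sum>g\<in>F. v g * g i) = (\<Sum>g\<in>X. (if g \<in> F then v g else 0) * g i)" for i
    using F(1) assms(1) by (intro sum.mono_neutral_cong_left) auto
  then show ?thesis using that[of "\<lambda>g. if g \<in> F then v g else 0"] F(2) by simp
qed

lemma int_span_lincomb:
  assumes "x \<in> int_span X" "y \<in> int_span Y"
  shows "(\<lambda>i. c * x i + d * y i) \<in> int_span (X \<union> Y)"
proof -
  obtain F v where F: "finite F" "F \<subseteq> X" "x = (\<lambda>i. \<Sum>g\<in>F. v g * g i)"
    using assms(1) by (auto simp: int_span_def)
  obtain G w where G: "finite G" "G \<subseteq> Y" "y = (\<lambda>i. \<Sum>g\<in>G. w g * g i)"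
    using assms(2) by (auto simp: int_span_def)
  define u where "u g = c * (if g \<in> F then v g else 0) + d * (if g \<in> G then w g else 0)" for g
  have "c * x i + d * y i = (\<Sum>g\<in>F \<union> G. u g * g i)" for i
  proof -
    have "x i = (\<Sum>g\<in>F \<union> G. (if g \<in> F then v g else 0) * g i)"
      unfolding F(3) using F(1) G(1) by (intro sum.mono_neutral_cong_left) auto
    moreover have "y i = (\<Sum>g\<in>F \<union> G. (if g \<in> G then w g else 0) * g i)"
      unfolding G(3) using F(1) G(1) by (intro sum.mono_neutral_cong_left) auto
    ultimately show ?thesis
      by (simp only: u_def distrib_right sum.distrib sum_distrib_left mult.assoc)
  qed
  moreover have "finite (F \<union> G)" "F \<union> G \<subseteq> X \<union> Y" using F G by auto
  ultimately show ?thesis unfolding int_span_def by blast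
qed

text \<open>Since v may identify indices, coefficients belonging to the same vector are added
  up.\<close>

lemma sum_in_int_span_image:
  assumes "finite F"
  shows "(\<lambda>i. \<Sum>a\<in>F. w a * v a i) \<in> int_span (v ` F)"
proof -
  have "(\<Sum>a\<in>F. w a * v a i) = (\<Sum>u\<in>v ` F. (\<Sum>a | a \<in> F \<and> v a = u. w a) * u i)" for i
    unfolding sum.image_gen[OF assms, of "\<lambda>a. w a * v a i" v] sum_distrib_right
    by (intro sum.cong refl) auto
  then show ?thesis unfolding int_span_def using assms by (auto intro!: exI[of _ "v ` F"])
qed

text \<open>Expanding the multiples \<open>c y * y\<close> over X turns a relation into a
  homogeneous system with fewer equations than unknowns. Its solution is rescaled by the nonzero
  factors \<open>c y\<close>.\<close>

lemma dependent_if_card_gt: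
  assumes "finite X" "finite Y" "card X < card Y"
    and "\<And>y. y \<in> Y \<Longrightarrow> \<exists>c. c \<noteq> 0 \<and> (\<lambda>i. c * y i) \<in> int_span X"
  shows "\<exists>b. (\<exists>y\<in>Y. b y \<noteq> 0) \<and> (\<forall>i. (\<Sum>y\<in>Y. b y * y i) = 0)"
proof -
  have "\<exists>c v. c \<noteq> 0 \<and> (\<forall>i. c * y i = (\<Sum>g\<in>X. v g * g i))" if "y \<in> Y" for y
  proof -
    obtain c where c: "c \<noteq> 0" "(\<lambda>i. c * y i) \<in> int_span X" using assms(4)[OF \<open>y \<in> Y\<close>] by blast
    obtain v where "(\<lambda>i. c * y i) = (\<lambda>i. \<Sum>g\<in>X. v g * g i)"
      by (rule int_span_finite[OF assms(1) c(2)])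
    then show ?thesis using c(1) by metis
  qed
  then obtain c v where c: "\<And>y. y \<in> Y \<Longrightarrow> c y \<noteq> 0"
    and v: "\<And>y i. y \<in> Y \<Longrightarrow> c y * y i = (\<Sum>g\<in>X. v y g * g i)" by metis
  obtain b where b: "\<exists>y\<in>Y. b y \<noteq> 0" "\<forall>g\<in>X. (\<Sum>y\<in>Y. b y * v y g) = 0"
    using homogeneous_system[OF assms(1,2,3), of v] by blast
  have "(\<Sum>y\<in>Y. b y * c y * y i) = 0" for i
  proof -
    have "(\<Sum>y\<in>Y. b y * c y * y i) = (\<Sum>y\<in>Y. \<Sum>g\<in>X. b y * v y g * g i)"
      by (intro sum.cong refl) (simp add: v mult.assoc sum_distrib_left)
    also have "\<dots> = (\<Sum>g\<in>X. (\<Sum>y\<in>Y. b y * v y g) * g i)"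
      unfolding sum_distrib_right by (rule sum.swap)
    also have "\<dots> = 0" using b(2) by simp
    finally show ?thesis .
  qed
  then show ?thesis using b(1) c by (intro exI[of _ "\<lambda>y. b y * c y"]) auto
qed

lemma comm_group_subgroup_bs_P: "subgroup H bs_P \<Longrightarrow> comm_group (bs_P\<lparr>carrier := H\<rparr>)"
  by (intro group.group_comm_groupI bs_P.subgroup_imp_group) (auto simp: add.commute)

lemma int_pow_subgroup_bs_P:
  assumes "subgroup H bs_P" "x \<in> H"
  shows "x [^]\<^bsub>bs_P\<lparr>carrier := H\<rparr>\<^esub> (n::int) = (\<lambda>i. n * x i)"
  unfolding bs_P.int_pow_consistent[OF assms, symmetric] by (rule int_pow_bs_P)

lemma finprod_subgroup_bs_P:
  assumes H: "subgroup H bs_P" and "finite F" "F \<subseteq> H"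
  shows "finprod (bs_P\<lparr>carrier := H\<rparr>) (\<lambda>x. x [^]\<^bsub>bs_P\<lparr>carrier := H\<rparr>\<^esub> (c x :: int)) F = (\<lambda>i. \<Sum>x\<in>F. c x * x i)"
  using assms(2,3)
proof (induction F rule: finite_induct)
  interpret comm_group "bs_P\<lparr>carrier := H\<rparr>"
    by (rule comm_group_subgroup_bs_P[OF H])
  case empty
  then show ?case by simp
next
  interpret comm_group "bs_P\<lparr>carrier := H\<rparr>"
    by (rule comm_group_subgroup_bs_P[OF H])
  case (insert y F)
  have *: "x [^]\<^bsub>bs_P\<lparr>carrier := H\<rparr>\<^esub> (c x :: int) \<in> carrier (bs_P\<lparr>carrier := H\<rparr>)"
    if "x \<in> insert y F" for x using that insert.prems by (intro int_pow_closed) auto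
  have "finprod (bs_P\<lparr>carrier := H\<rparr>) (\<lambda>x. x [^]\<^bsub>bs_P\<lparr>carrier := H\<rparr>\<^esub> c x) (insert y F) =
      y [^]\<^bsub>bs_P\<lparr>carrier := H\<rparr>\<^esub> c y \<otimes>\<^bsub>bs_P\<lparr>carrier := H\<rparr>\<^esub>
      finprod (bs_P\<lparr>carrier := H\<rparr>) (\<lambda>x. x [^]\<^bsub>bs_P\<lparr>carrier := H\<rparr>\<^esub> c x) F"
    using insert.hyps * by (intro finprod_insert) auto
  also have "\<dots> = (\<lambda>i. \<Sum>x\<in>insert y F. c x * x i)"
    using insert by (simp add: int_pow_subgroup_bs_P[OF H])
  finally show ?case .
qed

lemma int_independent_iff:
  assumes "subgroup H bs_P"
  shows "int_independent (bs_P\<lparr>carrier := H\<rparr>) X \<longleftrightarrow> X \<subseteq> H \<and>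
    (\<forall>F c. finite F \<and> F \<subseteq> X \<and> (\<forall>i. (\<Sum>x\<in>F. c x * x i) = 0) \<longrightarrow> (\<forall>x\<in>F. c x = 0))"
proof -
  have "finprod (bs_P\<lparr>carrier := H\<rparr>) (\<lambda>x. x [^]\<^bsub>bs_P\<lparr>carrier := H\<rparr>\<^esub> (c x :: int)) F = \<one>\<^bsub>bs_P\<lparr>carrier := H\<rparr>\<^esub>
      \<longleftrightarrow> (\<forall>i. (\<Sum>x\<in>F. c x * x i) = 0)" if "finite F" "F \<subseteq> H" for F c
    using finprod_subgroup_bs_P[OF assms that, of c] by (simp add: fun_eq_iff)
  note fp = this
  show ?thesis
  proof (cases "X \<subseteq> H")
    case True
    then have "(finite F \<and> F \<subseteq> X \<and> finprod (bs_P\<lparr>carrier := H\<rparr>) (\<lambda>x. x [^]\<^bsub>bs_P\<lparr>carrier := H\<rparr>\<^esub> (c x :: int)) F =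
        \<one>\<^bsub>bs_P\<lparr>carrier := H\<rparr>\<^esub>) \<longleftrightarrow> (finite F \<and> F \<subseteq> X \<and> (\<forall>i. (\<Sum>x\<in>F. c x * x i) = 0))" for F c
      using fp[of F c] by (metis (no_types, lifting) subset_trans)
    then show ?thesis unfolding int_independent_def by simp
  next
    case False
    then show ?thesis unfolding int_independent_def by simp
  qed
qed

lemma int_independentD:
  assumes "subgroup H bs_P" "int_independent (bs_P\<lparr>carrier := H\<rparr>) X"
    and "finite F" "F \<subseteq> X" "\<forall>i. (\<Sum>x\<in>F. c x * x i) = 0"
  shows "\<forall>x\<in>F. c x = 0"
  using assms(2-) unfolding int_independent_iff[OF assms(1)] by simp

text \<open>A maximal independent set spans H up to nonzero multiples. Conversely, a finite set X
  spanning up to multiples bounds the size of finite independent sets, and one of greatest size is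
  maximal. The right side allows X outside H, which makes it easy to verify for images of
  maps.\<close>

lemma finite_rank_iff:
  assumes H: "subgroup H bs_P"
  shows "finite_rank (bs_P\<lparr>carrier := H\<rparr>) \<longleftrightarrow>
    (\<exists>X. finite X \<and> (\<forall>y\<in>H. \<exists>c. c \<noteq> 0 \<and> (\<lambda>i. c * y i) \<in> int_span X))"
    (is "_ \<longleftrightarrow> ?rhs")
proof
  let ?ind = "int_independent (bs_P\<lparr>carrier := H\<rparr>)"
  assume "finite_rank (bs_P\<lparr>carrier := H\<rparr>)"
  then obtain X where X: "finite X" "?ind X" "\<And>Y. ?ind Y \<Longrightarrow> X \<subseteq> Y \<Longrightarrow> Y = X"
    unfolding finite_rank_def by blast
  have "\<exists>c. c \<noteq> 0 \<and> (\<lambda>i. c * y i) \<in> int_span X" if y: "y \<in> H" for y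
  proof (cases "y \<in> X")
    case True
    then have "(\<lambda>i. 1 * y i) \<in> int_span X"
      unfolding int_span_def by (auto intro!: exI[of _ "{y}"] exI[of _ "\<lambda>_. 1"])
    then show ?thesis using zero_neq_one by metis
  next
    case False
    then have "\<not> ?ind (insert y X)" using X(3)[of "insert y X"] by auto
    moreover have "insert y X \<subseteq> H" using X(2) y by (simp add: int_independent_iff[OF H])
    ultimately have "\<exists>F c. (finite F \<and> F \<subseteq> insert y X \<and> (\<forall>i. (\<Sum>x\<in>F. c x * x i) = 0)) \<and> (\<exists>x\<in>F. c x \<noteq> 0)"
      unfolding int_independent_iff[OF H] by simp
    then obtain F c where "(finite F \<and> F \<subseteq> insert y X \<and> (\<forall>i. (\<Sum>x\<in>F. c x * x i) = 0)) \<and> (\<exists>x\<in>F. c x \<noteq> 0)"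
      by (elim exE) (rule that)
    then have F: "finite F" "F \<subseteq> insert y X" "\<And>i. (\<Sum>x\<in>F. c x * x i) = 0" "\<exists>x\<in>F. c x \<noteq> 0"
      by simp_all
    have split: "(if y \<in> F then c y else 0) * y i + (\<Sum>x\<in>F - {y}. c x * x i) = 0" for i
      using F(1,3) by (cases "y \<in> F") (simp_all add: sum.remove)
    \<comment> \<open>With coefficient 0 at y the relation would live inside X and be trivial by
      independence.\<close>
    have nz: "(if y \<in> F then c y else 0) \<noteq> 0"
    proof
      assume 0: "(if y \<in> F then c y else 0) = 0"
      then have "\<forall>i. (\<Sum>x\<in>F - {y}. c x * x i) = 0" using split by simp
      then have "\<forall>x\<in>F - {y}. c x = 0"
        using F(1,2) by (intro int_independentD[OF H X(2)]) auto
      then show False using 0 F(4) by (auto split: if_splits)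
    qed
    have eq: "(\<lambda>i. (if y \<in> F then c y else 0) * y i) = (\<lambda>i. \<Sum>x\<in>F - {y}. (- c x) * x i)"
      unfolding mult_minus_left sum_negf eq_neg_iff_add_eq_0 by (intro ext) (use split in \<open>simp only: eq_neg_iff_add_eq_0\<close>)
    have "(\<lambda>i. \<Sum>x\<in>F - {y}. (- c x) * x i) \<in> int_span X"
      using F(1,2) unfolding int_span_def by (intro CollectI exI[of _ "F - {y}"] exI[of _ "\<lambda>x. - c x"]) auto
    then have "(\<lambda>i. (if y \<in> F then c y else 0) * y i) \<in> int_span X" by (simp only: eq)
    with nz show ?thesis by blast
  qed
  then show ?rhs using X(1) by blast
next
  let ?ind = "int_independent (bs_P\<lparr>carrier := H\<rparr>)"
  assume ?rhs
  then obtain X where X: "finite X" "\<And>y. y \<in> H \<Longrightarrow> \<exists>c. c \<noteq> 0 \<and> (\<lambda>i. c * y i) \<in> int_span X" by blast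
  have bound: "card Y \<le> card X" if Y: "finite Y" "?ind Y" for Y
  proof (rule ccontr)
    assume "\<not> card Y \<le> card X"
    then have "card X < card Y" by simp
    moreover have "Y \<subseteq> H" using Y(2) by (simp add: int_independent_iff[OF H])
    ultimately have "\<exists>b. (\<exists>y\<in>Y. b y \<noteq> 0) \<and> (\<forall>i. (\<Sum>y\<in>Y. b y * y i) = 0)"
      using X(2) by (intro dependent_if_card_gt[OF X(1) Y(1)]) auto
    then show False using int_independentD[OF H Y(2) Y(1)] by blast
  qed
  have "finite {} \<and> ?ind {}" by (auto simp: int_independent_iff[OF H])
  then obtain Z where Z: "finite Z \<and> ?ind Z" "\<And>Y. finite Y \<and> ?ind Y \<Longrightarrow> card Y \<le> card Z"
    using ex_has_greatest_nat[of "\<lambda>Y. finite Y \<and> ?ind Y" "{}" card "Suc (card X)"] bound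
    by (auto simp: less_Suc_eq_le)
  have "Y = Z" if Y: "?ind Y" "Z \<subseteq> Y" for Y
  proof (rule ccontr)
    assume "Y \<noteq> Z"
    then obtain y where y: "y \<in> Y" "y \<notin> Z" using Y(2) by blast
    then have "insert y Z \<subseteq> Y" using Y(2) by blast
    then have "?ind (insert y Z)"
      using Y(1) unfolding int_independent_def by (meson subset_trans)
    then have "card (insert y Z) \<le> card Z" using Z by blast
    then show False using Z(1) y(2) by simp
  qed
  then show "finite_rank (bs_P\<lparr>carrier := H\<rparr>)" unfolding finite_rank_def using Z(1) by blast
qed

subsection \<open>The group orthogonal to a set of sequences\<close>

definition integral_subgroup :: "(nat \<Rightarrow> int) set \<Rightarrow> (nat \<Rightarrow> int) set" where
  "integral_subgroup A = {x \<in> bs_D. \<forall>b\<in>A. integral_at b x}"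

lemma bs_D_lincomb:
  assumes "x \<in> bs_D" "y \<in> bs_D"
  shows "(\<lambda>i. c * x i + d * y i) \<in> bs_D"
  unfolding bs_D_iff
proof (intro allI impI)
  fix M :: int assume "M \<noteq> 0"
  then have "\<forall>\<^sub>F i in sequentially. M dvd x i" "\<forall>\<^sub>F i in sequentially. M dvd y i"
    using assms by (auto simp: bs_D_iff)
  then show "\<forall>\<^sub>F i in sequentially. M dvd c * x i + d * y i"
    by eventually_elim simp
qed

lemma integral_subgroup_lincomb:
  assumes "x \<in> integral_subgroup A" "y \<in> integral_subgroup A"
  shows "(\<lambda>i. c * x i + d * y i) \<in> integral_subgroup A"
  using assms bs_D_lincomb dot_lim_lincomb_right unfolding integral_subgroup_def by blast

lemma bs_S_subset_integral_subgroup: "bs_S \<subseteq> integral_subgroup A"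
  using bs_S_subset_bs_D dot_lim_bs_S by (auto simp: integral_subgroup_def)

lemma subgroup_integral_subgroup: "subgroup (integral_subgroup A) bs_P"
  unfolding subgroup_bs_P_iff
proof (intro conjI ballI)
  have "(\<lambda>i. 0) \<in> bs_S" by (auto simp: bs_S_iff)
  then show "(\<lambda>i. 0) \<in> integral_subgroup A"
    using bs_S_subset_integral_subgroup by blast
next
  fix x y assume "x \<in> integral_subgroup A" "y \<in> integral_subgroup A"
  from integral_subgroup_lincomb[OF this, of 1 1]
  show "(\<lambda>i. x i + y i) \<in> integral_subgroup A" by simp
next
  fix x assume "x \<in> integral_subgroup A"
  from integral_subgroup_lincomb[OF this this, of "-1" 0]
  show "(\<lambda>i. - x i) \<in> integral_subgroup A" by simp
qed

text \<open>The value z at \<open>n x\<close> is congruent modulo n to partial sums divisible by n,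
  so n divides z. Testing \<open>n x\<close> modulo \<open>n * M\<close> amounts to testing x modulo
  M, both for membership in D and for the value z / n.\<close>

lemma integral_subgroup_divide:
  assumes "(\<lambda>i. n * x i) \<in> integral_subgroup A" "n \<noteq> 0"
  shows "x \<in> integral_subgroup A"
  unfolding integral_subgroup_def
proof (intro CollectI conjI ballI)
  show "x \<in> bs_D"
    unfolding bs_D_iff
  proof (intro allI impI)
    fix M :: int assume "M \<noteq> 0"
    then have "n * M \<noteq> 0" using assms(2) by simp
    moreover have "(\<lambda>i. n * x i) \<in> bs_D" using assms(1) by (simp add: integral_subgroup_def)
    ultimately have "\<forall>\<^sub>F i in sequentially. n * M dvd n * x i"
      unfolding bs_D_iff by blast
    then show "\<forall>\<^sub>F i in sequentially. M dvd x i"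
      by eventually_elim (use assms(2) in simp)
  qed
  fix b assume "b \<in> A"
  then obtain z where z: "dot_lim b (\<lambda>i. n * x i) z"
    using assms(1) by (auto simp: integral_subgroup_def)
  have sum: "(\<Sum>i<N. b i * (n * x i)) = n * (\<Sum>i<N. b i * x i)" for N
    by (simp add: sum_distrib_left algebra_simps)
  have "\<forall>\<^sub>F N in sequentially. n dvd n * (\<Sum>i<N. b i * x i) - z"
    using z assms(2) unfolding dot_lim_def sum by blast
  from eventually_happens'[OF sequentially_bot this]
  obtain N where "n dvd n * (\<Sum>i<N. b i * x i) - z" by blast
  then have "n dvd z" by (simp add: dvd_diff_right_iff)
  then obtain w where w: "z = n * w" by blast
  have "dot_lim b x w"
    unfolding dot_lim_def
  proof (intro allI impI)
    fix M :: int assume "M \<noteq> 0"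
    then have "n * M \<noteq> 0" using assms(2) by simp
    then have "\<forall>\<^sub>F N in sequentially. n * M dvd n * (\<Sum>i<N. b i * x i) - z"
      using z unfolding dot_lim_def sum by blast
    then show "\<forall>\<^sub>F N in sequentially. M dvd (\<Sum>i<N. b i * x i) - w"
      by eventually_elim (use assms(2) in \<open>simp add: w flip: right_diff_distrib\<close>)
  qed
  then show "integral_at b x" by blast
qed

lemma pure_integral_subgroup:
  assumes H: "subgroup H bs_P" "integral_subgroup A \<subseteq> H"
  shows "pure_subgroup (integral_subgroup A) (bs_P\<lparr>carrier := H\<rparr>)"
  unfolding pure_subgroup_def
proof (intro conjI allI)
  show "subgroup (integral_subgroup A) (bs_P\<lparr>carrier := H\<rparr>)"
    by (rule bs_P.subgroup_incl[OF subgroup_integral_subgroup H(1,2)])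
  fix n :: int
  have mult: "multiples (bs_P\<lparr>carrier := H\<rparr>) n B = (\<lambda>x i. n * x i) ` B" if "B \<subseteq> H" for B
    unfolding multiples_def using that int_pow_subgroup_bs_P[OF H(1)] by (intro image_cong) auto
  show "integral_subgroup A \<inter> multiples (bs_P\<lparr>carrier := H\<rparr>) n (carrier (bs_P\<lparr>carrier := H\<rparr>)) =
      multiples (bs_P\<lparr>carrier := H\<rparr>) n (integral_subgroup A)"
  proof -
    have "integral_subgroup A \<inter> (\<lambda>x i. n * x i) ` H = (\<lambda>x i. n * x i) ` integral_subgroup A"
    proof (intro equalityI subsetI)
      fix y assume "y \<in> integral_subgroup A \<inter> (\<lambda>x i. n * x i) ` H"
      then obtain x where x: "y = (\<lambda>i. n * x i)" "y \<in> integral_subgroup A" by blast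
      show "y \<in> (\<lambda>x i. n * x i) ` integral_subgroup A"
      proof (cases "n = 0")
        case True
        \<comment> \<open>For n = 0 the element y is zero and is its own preimage.\<close>
        then show ?thesis using x by (intro image_eqI[of _ _ y]) auto
      next
        case False
        then show ?thesis using x integral_subgroup_divide[of n x A] by blast
      qed
    next
      fix y assume "y \<in> (\<lambda>x i. n * x i) ` integral_subgroup A"
      then obtain x where x: "y = (\<lambda>i. n * x i)" "x \<in> integral_subgroup A" by blast
      then show "y \<in> integral_subgroup A \<inter> (\<lambda>x i. n * x i) ` H"
        using H(2) integral_subgroup_lincomb[OF x(2) x(2), of n 0] by auto
    qed
    then show ?thesis using mult[OF H(2)] mult[of H] by simp
  qed
qed

lemma subgroup_bs_D: "subgroup bs_D bs_P"
  unfolding subgroup_bs_P_iff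
proof (intro conjI ballI)
  show "(\<lambda>i. 0) \<in> bs_D" by (simp add: bs_D_iff)
  show "(\<lambda>i. x i + y i) \<in> bs_D" if "x \<in> bs_D" "y \<in> bs_D" for x y
    using bs_D_lincomb[OF that, of 1 1] by simp
  show "(\<lambda>i. - x i) \<in> bs_D" if "x \<in> bs_D" for x
    using bs_D_lincomb[OF that that, of "-1" 0] by simp
qed

text \<open>Transfers an identity of functionals from S to limits: modulo M, truncating x at a
  common large N computes all values involved.\<close>

lemma dot_identity_dot_lim:
  assumes "finite F"
    and eq: "\<And>s. s \<in> bs_S \<Longrightarrow> c * dot p s = (\<Sum>a\<in>F. dot a s * v a)"
    and "\<And>a. a \<in> F \<Longrightarrow> dot_lim a x (z a)" and "dot_lim p x w"
  shows "c * w = (\<Sum>a\<in>F. z a * v a)"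
proof (rule int_eq_if_all_dvd_diff)
  fix M :: int assume M: "M \<noteq> 0"
  have "\<forall>\<^sub>F N in sequentially. M dvd (\<Sum>i<N. p i * x i) - w \<and> (\<forall>a\<in>F. M dvd (\<Sum>i<N. a i * x i) - z a)"
    using assms M unfolding dot_lim_def by (intro eventually_conj eventually_ball_finite) auto
  from eventually_happens'[OF sequentially_bot this] obtain N
    where N: "M dvd (\<Sum>i<N. p i * x i) - w" "\<And>a. a \<in> F \<Longrightarrow> M dvd (\<Sum>i<N. a i * x i) - z a" by blast
  define s where "s i = (if i < N then x i else 0)" for i
  have s: "s \<in> bs_S" unfolding bs_S_iff s_def by (rule exI[of _ N]) simp
  have dot: "dot b s = (\<Sum>i<N. b i * x i)" for b
    using dot_eq_sum[of N s b] by (simp add: s_def)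
  have p: "M dvd c * (dot p s - w)" using N(1) by (simp add: dot)
  have "M dvd (\<Sum>a\<in>F. dot a s * v a) - (\<Sum>a\<in>F. z a * v a)"
    using N(2) by (intro sum_cong_dvd) (simp add: dot flip: left_diff_distrib)
  from dvd_diff[OF this p] show "M dvd c * w - (\<Sum>a\<in>F. z a * v a)"
    using eq[OF s] by (simp add: algebra_simps)
qed

text \<open>A nonzero element of the kernel is divided by the gcd of its entries.\<close>

lemma exists_primitive_in_joint_kernel:
  assumes "finite F"
  shows "\<exists>t\<in>bs_S. (\<forall>a\<in>F. dot a t = 0) \<and> Gcd (range t) = 1"
proof -
  obtain s k where s: "s \<in> bs_S" "\<forall>a\<in>F. dot a s = 0" "s k \<noteq> 0"
    using exists_nonzero_in_joint_kernel[OF assms] by blast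
  define d where "d = Gcd (range s)"
  have d: "d \<noteq> 0" using s(3) by (auto simp: d_def Gcd_0_iff)
  define t where "t i = s i div d" for i
  have st: "s = (\<lambda>i. d * t i)" by (auto simp: t_def d_def)
  have t: "t \<in> bs_S" using s(1) unfolding bs_S_iff t_def by (metis div_0)
  have "dot a s = d * dot a t" for a
    using dot_lincomb[OF t t, of a d 0] by (simp add: st)
  then have "\<forall>a\<in>F. dot a t = 0" using s(2) d by simp
  moreover have "range s = (*) d ` range t" using st by auto
  then have "d = normalize (d * Gcd (range t))" using Gcd_mult[of d "range t"] d_def by simp
  then have "Gcd (range t) = 1" using d by (simp add: abs_mult d_def)
  ultimately show ?thesis using t by blast
qed

subsection \<open>Endomorphisms and the dual\<close>

abbreviation bs_sub :: "(nat \<Rightarrow> int) set \<Rightarrow> (nat \<Rightarrow> int) monoid" where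
  "bs_sub H \<equiv> bs_P\<lparr>carrier := H\<rparr>"

lemma hom_bs_sub_lincomb:
  assumes G: "subgroup G bs_P" and H: "subgroup H bs_P" and f: "f \<in> hom (bs_sub G) (bs_sub H)"
    and x: "x \<in> G" "y \<in> G"
  shows "f (\<lambda>i. c * x i + d * y i) = (\<lambda>i. c * f x i + d * f y i)"
proof -
  interpret f: group_hom "bs_sub G" "bs_sub H" f
    using f bs_P.subgroup_imp_group[OF G] bs_P.subgroup_imp_group[OF H]
    by (simp add: group_hom_def group_hom_axioms_def)
  have fx: "f x \<in> H" if "x \<in> G" for x using f.hom_closed[of x] that by simp
  have scale: "f (\<lambda>i. n * x i) = (\<lambda>i. n * f x i)" and closed: "(\<lambda>i. n * x i) \<in> G" if "x \<in> G" for x n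
    using f.hom_int_pow[of x n] f.G.int_pow_closed[of x n] that fx[OF that]
    by (simp_all add: int_pow_subgroup_bs_P[OF G] int_pow_subgroup_bs_P[OF H])
  show ?thesis
    using f.hom_mult[of "\<lambda>i. c * x i" "\<lambda>i. d * y i"] closed scale x by simp
qed

text \<open>Endomorphisms are continuous in the \<open>\<int>\<close>-adic sense: a tail of x is M
  times an element of the group, so its image is divisible by M. Hence f is determined by its values
  on unit sequences and can be encoded as a \<open>\<Phi>\<close>.\<close>

lemma hom_bs_sub_dot_lim:
  assumes f: "f \<in> hom (bs_sub (integral_subgroup A)) (bs_sub (integral_subgroup A))"
    and x: "x \<in> integral_subgroup A"
  shows "dot_lim (\<lambda>i. f (unit_seq i) k) x (f x k)"
proof -
  let ?G = "integral_subgroup A"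
  note lincomb = hom_bs_sub_lincomb[OF subgroup_integral_subgroup subgroup_integral_subgroup f]
  have S: "s \<in> ?G" if "s \<in> bs_S" for s using that bs_S_subset_integral_subgroup by blast
  have trunc_S: "(\<lambda>i. if i < N then x i else 0) \<in> bs_S" for N
    unfolding bs_S_iff by (rule exI[of _ N]) simp
  have trunc: "f (\<lambda>i. if i < N then x i else 0) k = (\<Sum>i<N. f (unit_seq i) k * x i)" for N
  proof (induction N)
    case 0
    have "f (\<lambda>i. 0 * x i + 0 * x i) k = 0" by (subst lincomb[OF x x]) simp
    then show ?case by simp
  next
    case (Suc N)
    have "(\<lambda>i. if i < Suc N then x i else 0) =
        (\<lambda>i. 1 * (if i < N then x i else 0) + x N * unit_seq N i)"
      by (auto simp: unit_seq_def less_Suc_eq)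
    then have "f (\<lambda>i. if i < Suc N then x i else 0) k =
        f (\<lambda>i. if i < N then x i else 0) k + x N * f (unit_seq N) k"
      using lincomb[OF S[OF trunc_S] S[OF unit_seq_in_bs_S], of 1 N "x N" N] by simp
    then show ?case using Suc.IH by simp
  qed
  show ?thesis
    unfolding dot_lim_def
  proof (intro allI impI)
    fix M :: int assume M: "M \<noteq> 0"
    have "x \<in> bs_D" using x by (simp add: integral_subgroup_def)
    then obtain N0 where N0: "\<And>i. i \<ge> N0 \<Longrightarrow> M dvd x i"
      using M unfolding bs_D_iff eventually_sequentially by blast
    have "M dvd (\<Sum>i<N. f (unit_seq i) k * x i) - f x k" if N: "N \<ge> N0" for N
    proof -
      define s where "s i = (if i < N then x i else 0)" for i
      \<comment> \<open>The tail of x from N on is \<open>M * y\<close>, and purity puts y into the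
        group, so f may be applied to it.\<close>
      define y where "y i = (if i < N then 0 else x i div M)" for i
      have sG: "s \<in> ?G" unfolding s_def by (rule S[OF trunc_S])
      have My: "(\<lambda>i. M * y i) = (\<lambda>i. 1 * x i + (-1) * s i)"
        using N0 N by (auto simp: s_def y_def)
      have yG: "y \<in> ?G"
        by (rule integral_subgroup_divide[OF _ M]) (unfold My, rule integral_subgroup_lincomb[OF x sG])
      have "f x = f (\<lambda>i. 1 * s i + M * y i)" using fun_cong[OF My] by (intro arg_cong[of _ _ f]) (auto simp: fun_eq_iff)
      then have "f x k = f s k + M * f y k" using lincomb[OF sG yG, of 1 M] by simp
      moreover have "f s k = (\<Sum>i<N. f (unit_seq i) k * x i)" using trunc[of N] by (simp add: s_def[abs_def])
      ultimately show ?thesis by simp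
    qed
    then show "\<forall>\<^sub>F N in sequentially. M dvd (\<Sum>i<N. f (unit_seq i) k * x i) - f x k"
      unfolding eventually_sequentially by blast
  qed
qed

text \<open>The criterion of \<open>finite_rank_iff\<close> for the image of G, stated for arbitrary
  functions so that it applies directly to differences such as \<open>f x - z x\<close>.\<close>

definition finite_rank_on :: "(nat \<Rightarrow> int) set \<Rightarrow> ((nat \<Rightarrow> int) \<Rightarrow> nat \<Rightarrow> int) \<Rightarrow> bool" where
  "finite_rank_on G f \<longleftrightarrow> (\<exists>X. finite X \<and> (\<forall>x\<in>G. \<exists>c. c \<noteq> 0 \<and> (\<lambda>i. c * f x i) \<in> int_span X))"

text \<open>On S, a multiple of \<open>m f + n\<close> factors through the finitely many functionals
  in F; the identity passes to limits, where those functionals still take integer values. What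
  remains is to divide by m.\<close>

lemma almost_scalar_mod_imp_almost_scalar:
  assumes f: "f \<in> hom (bs_sub (integral_subgroup A)) (bs_sub (integral_subgroup A))"
    and as: "almost_scalar_mod A (\<lambda>k i. f (unit_seq i) k)"
  shows "\<exists>z. finite_rank_on (integral_subgroup A) (\<lambda>x i. f x i - z * x i)"
proof -
  let ?G = "integral_subgroup A"
  obtain m n F where m: "m \<noteq> 0" and F: "finite F" "F \<subseteq> A"
    and ker: "\<And>t k. t \<in> bs_S \<Longrightarrow> \<forall>a\<in>F. dot a t = 0 \<Longrightarrow> dot (\<lambda>i. m * f (unit_seq i) k + n * unit_seq k i) t = 0"
    using as unfolding almost_scalar_mod_def by blast
  obtain c v where c: "c \<noteq> 0" and v: "\<And>s k. s \<in> bs_S \<Longrightarrow>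
      c * dot (\<lambda>i. m * f (unit_seq i) k + n * unit_seq k i) s = (\<Sum>a\<in>F. dot a s * v a k)"
    using factor_through_functionals[OF F(1) order_refl bs_S_lincomb,
        of "\<lambda>k i. m * f (unit_seq i) k + n * unit_seq k i"] ker by blast
  have lim: "dot_lim (\<lambda>i. m * f (unit_seq i) k + n * unit_seq k i) x (m * f x k + n * x k)"
    if "x \<in> ?G" for x k
    by (intro dot_lim_lincomb_left hom_bs_sub_dot_lim[OF f that] dot_lim_unit_left)
  obtain t where t: "t \<in> bs_S" "\<forall>a\<in>F. dot a t = 0" "Gcd (range t) = 1"
    using exists_primitive_in_joint_kernel[OF F(1)] by blast
  \<comment> \<open>At t the map \<open>m f + n\<close> vanishes, so m divides n times each entry of
    t, hence n times their gcd, which is 1.\<close>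
  have "m dvd n"
  proof -
    have "m * f t k + n * t k = 0" for k
    proof -
      have "t \<in> ?G" using t(1) bs_S_subset_integral_subgroup by blast
      from dot_lim_unique[OF lim[OF this] dot_lim_bs_S[OF t(1)]] show ?thesis
        using ker[OF t(1,2)] by simp
    qed
    then have "m dvd n * t k" for k by (metis dvd_add_right_iff dvd_triv_left dvd_0_right)
    then have "m dvd Gcd ((*) n ` range t)" by (intro Gcd_greatest) auto
    then show ?thesis by (simp add: Gcd_mult t(3))
  qed
  then obtain z where z: "n = m * z" by blast
  \<comment> \<open>Now \<open>m f + n = m (f + z)\<close>, so the scalar part of f is -z.\<close>
  have "finite_rank_on ?G (\<lambda>x i. f x i - (- z) * x i)"
    unfolding finite_rank_on_def
  proof (intro exI[of _ "v ` F"] conjI ballI)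
    show "finite (v ` F)" using F(1) by simp
    fix x assume x: "x \<in> ?G"
    then have "\<forall>a\<in>F. \<exists>w. dot_lim a x w" using F(2) by (auto simp: integral_subgroup_def)
    then obtain w where w: "\<And>a. a \<in> F \<Longrightarrow> dot_lim a x (w a)" by metis
    have "c * (m * f x k + n * x k) = (\<Sum>a\<in>F. w a * v a k)" for k
      by (rule dot_identity_dot_lim[OF F(1) v w lim[OF x]])
    then have "(\<lambda>i. c * m * (f x i - (- z) * x i)) = (\<lambda>k. \<Sum>a\<in>F. w a * v a k)"
      by (simp add: z algebra_simps)
    then have "(\<lambda>i. c * m * (f x i - (- z) * x i)) \<in> int_span (v ` F)"
      using sum_in_int_span_image[OF F(1), of w v] by simp
    then show "\<exists>d. d \<noteq> 0 \<and> (\<lambda>i. d * (f x i - (- z) * x i)) \<in> int_span (v ` F)"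
      using c m by (intro exI[of _ "c * m"]) simp
  qed
  then show ?thesis by blast
qed

lemma finite_rank_on_lincomb:
  assumes "finite_rank_on G f" "finite_rank_on G g"
  shows "finite_rank_on G (\<lambda>x i. a * f x i + b * g x i)"
proof -
  obtain X where X: "finite X" "\<And>x. x \<in> G \<Longrightarrow> \<exists>c. c \<noteq> 0 \<and> (\<lambda>i. c * f x i) \<in> int_span X"
    using assms(1) unfolding finite_rank_on_def by blast
  obtain Y where Y: "finite Y" "\<And>x. x \<in> G \<Longrightarrow> \<exists>c. c \<noteq> 0 \<and> (\<lambda>i. c * g x i) \<in> int_span Y"
    using assms(2) unfolding finite_rank_on_def by blast
  show ?thesis
    unfolding finite_rank_on_def
  proof (intro exI[of _ "X \<union> Y"] conjI ballI)
    show "finite (X \<union> Y)" using X Y by simp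
    fix x assume x: "x \<in> G"
    obtain c where c: "c \<noteq> 0" "(\<lambda>i. c * f x i) \<in> int_span X" using X(2)[OF x] by blast
    obtain d where d: "d \<noteq> 0" "(\<lambda>i. d * g x i) \<in> int_span Y" using Y(2)[OF x] by blast
    have "(\<lambda>i. (d * a) * (c * f x i) + (c * b) * (d * g x i)) \<in> int_span (X \<union> Y)"
      by (rule int_span_lincomb[OF c(2) d(2)])
    then have "(\<lambda>i. (c * d) * (a * f x i + b * g x i)) \<in> int_span (X \<union> Y)"
      by (simp add: algebra_simps)
    then show "\<exists>e. e \<noteq> 0 \<and> (\<lambda>i. e * (a * f x i + b * g x i)) \<in> int_span (X \<union> Y)"
      using c(1) d(1) by (intro exI[of _ "c * d"]) simp
  qed
qed

text \<open>Otherwise nonzero multiples of all unit sequences lie in the span of a finite set X,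
  making \<open>card X + 1\<close> of them dependent.\<close>

lemma scalar_not_finite_rank_on:
  assumes "bs_S \<subseteq> G" "finite_rank_on G (\<lambda>x i. z * x i)"
  shows "z = 0"
proof (rule ccontr)
  assume z: "z \<noteq> 0"
  obtain X where X: "finite X" "\<And>x. x \<in> G \<Longrightarrow> \<exists>c. c \<noteq> 0 \<and> (\<lambda>i. c * (z * x i)) \<in> int_span X"
    using assms(2) unfolding finite_rank_on_def by blast
  have inj: "inj unit_seq"
  proof (rule injI)
    fix j k assume "unit_seq j = unit_seq k"
    from fun_cong[OF this, of j] show "j = k" by (simp add: unit_seq_def split: if_splits)
  qed
  let ?Y = "unit_seq ` {..card X}"
  have "\<exists>b. (\<exists>y\<in>?Y. b y \<noteq> 0) \<and> (\<forall>i. (\<Sum>y\<in>?Y. b y * y i) = 0)"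
  proof (rule dependent_if_card_gt[OF X(1)])
    show "card X < card ?Y" using inj by (simp add: card_image inj_on_subset[OF inj])
    show "\<exists>c. c \<noteq> 0 \<and> (\<lambda>i. c * y i) \<in> int_span X" if y: "y \<in> ?Y" for y
    proof -
      have "y \<in> G" using y assms(1) by auto
      then obtain c where "c \<noteq> 0" "(\<lambda>i. c * (z * y i)) \<in> int_span X" using X(2) by blast
      then show ?thesis using z by (intro exI[of _ "c * z"]) (simp add: mult.assoc)
    qed
  qed simp
  then obtain b j where b: "j \<le> card X" "b (unit_seq j) \<noteq> 0" "\<And>i. (\<Sum>y\<in>?Y. b y * y i) = 0" by auto
  have "(\<Sum>y\<in>?Y. b y * y j) = (\<Sum>i\<le>card X. b (unit_seq i) * unit_seq i j)"
    using inj by (subst sum.reindex) (auto intro: inj_on_subset)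
  also have "\<dots> = b (unit_seq j)"
    using b(1) by (subst sum.remove[of _ j]) (auto simp: unit_seq_def)
  finally show False using b(2,3) by simp
qed


section \<open>The direct sum decomposition and the dual group\<close>

lemma Fin_bs_sub_eq:
  assumes G: "subgroup G bs_P"
  shows "Fin (bs_sub G) = {f \<in> carrier (End (bs_sub G)). finite_rank_on G f}"
proof -
  have "finite_rank ((bs_sub G)\<lparr>carrier := f ` carrier (bs_sub G)\<rparr>) \<longleftrightarrow> finite_rank_on G f"
    if f: "f \<in> carrier (End (bs_sub G))" for f
  proof -
    have "group_hom (bs_sub G) (bs_sub G) f"
      using f bs_P.subgroup_imp_group[OF G] by (simp add: End_def group_hom_def group_hom_axioms_def)
    from group_hom.img_is_subgroup[OF this] have "subgroup (f ` G) bs_P"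
      using bs_P.incl_subgroup[OF G] by simp
    from finite_rank_iff[OF this] show ?thesis by (simp add: finite_rank_on_def)
  qed
  then show ?thesis unfolding Fin_def by blast
qed

lemma Scalar_bs_sub_eq:
  assumes G: "subgroup G bs_P"
  shows "Scalar (bs_sub G) = range (\<lambda>z. \<lambda>x\<in>G. \<lambda>i. z * x i)"
proof -
  have "(\<lambda>x\<in>carrier (bs_sub G). x [^]\<^bsub>bs_sub G\<^esub> z) = (\<lambda>x\<in>G. \<lambda>i. z * x i)" for z :: int
    by (simp add: int_pow_subgroup_bs_P[OF G] cong: restrict_cong)
  then show ?thesis unfolding Scalar_def by simp
qed

lemma End_bs_sub_memI:
  assumes "f \<in> extensional G" "\<And>x. x \<in> G \<Longrightarrow> f x \<in> G"
    and "\<And>x y. x \<in> G \<Longrightarrow> y \<in> G \<Longrightarrow> f (\<lambda>i. x i + y i) = (\<lambda>i. f x i + f y i)"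
  shows "f \<in> carrier (End (bs_sub G))"
  using assms by (simp add: End_def hom_def)

lemma a_inv_End_bs_sub:
  assumes G: "subgroup G bs_P" and f: "f \<in> carrier (End (bs_sub G))"
  shows "inv\<^bsub>add_monoid (End (bs_sub G))\<^esub> f = (\<lambda>x\<in>G. \<lambda>i. - f x i)"
proof (rule group.inv_equality)
  interpret ring "End (bs_sub G)" by (rule ring_End[OF comm_group_subgroup_bs_P[OF G]])
  show "group (add_monoid (End (bs_sub G)))" by (rule a_group)
  have fG: "f x \<in> G" if "x \<in> G" for x
    using f that by (auto simp: End_def hom_def)
  have add: "f (\<lambda>i. x i + y i) = (\<lambda>i. f x i + f y i)" if "x \<in> G" "y \<in> G" for x y
    using f that by (auto simp: End_def hom_def)
  show "(\<lambda>x\<in>G. \<lambda>i. - f x i) \<in> carrier (add_monoid (End (bs_sub G)))"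
    using G fG by (auto intro!: End_bs_sub_memI simp: subgroup_bs_P_iff add)
  show "(\<lambda>x\<in>G. \<lambda>i. - f x i) \<otimes>\<^bsub>add_monoid (End (bs_sub G))\<^esub> f = \<one>\<^bsub>add_monoid (End (bs_sub G))\<^esub>"
    by (auto simp: End_def fun_eq_iff)
  show "f \<in> carrier (add_monoid (End (bs_sub G)))" using f by simp
qed

lemma internal_direct_sum_Scalar_Fin:
  assumes G: "subgroup G bs_P" "bs_S \<subseteq> G"
    and almost: "\<And>f. f \<in> hom (bs_sub G) (bs_sub G) \<Longrightarrow> \<exists>z. finite_rank_on G (\<lambda>x i. f x i - z * x i)"
  shows "internal_direct_sum (End (bs_sub G)) (Scalar (bs_sub G)) (Fin (bs_sub G))"
proof -
  let ?E = "End (bs_sub G)"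
  interpret ring ?E by (rule ring_End[OF comm_group_subgroup_bs_P[OF G(1)]])
  have add: "f \<oplus>\<^bsub>?E\<^esub> g = (\<lambda>x\<in>G. \<lambda>i. f x i + g x i)" for f g by (simp add: End_def)
  have zero: "\<zero>\<^bsub>?E\<^esub> = (\<lambda>x\<in>G. \<lambda>i. 0)" by (simp add: End_def)
  have scaleG: "(\<lambda>i. z * x i) \<in> G" if "x \<in> G" for x z
    using bs_P.subgroup_int_pow_closed[OF G(1) that, of z] by simp
  have scal: "(\<lambda>x\<in>G. \<lambda>i. z * x i) \<in> carrier ?E" for z
    using G(1) scaleG by (intro End_bs_sub_memI) (auto simp: subgroup_bs_P_iff algebra_simps)
  have frank: "finite_rank_on G f \<longleftrightarrow> finite_rank_on G g" if "\<And>x. x \<in> G \<Longrightarrow> f x = g x" for f g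
    unfolding finite_rank_on_def using that by simp
  note Scalar = Scalar_bs_sub_eq[OF G(1)] and Fin = Fin_bs_sub_eq[OF G(1)]
  have closed: "f x \<in> G" if "f \<in> carrier ?E" "x \<in> G" for f x
    using that by (auto simp: End_def hom_def)
  have "subgroup (Scalar (bs_sub G)) (add_monoid ?E)"
  proof (rule group.subgroupI[OF a_group])
    show "Scalar (bs_sub G) \<subseteq> carrier (add_monoid ?E)" using scal by (auto simp: Scalar)
    show "Scalar (bs_sub G) \<noteq> {}" by (auto simp: Scalar)
    show "inv\<^bsub>add_monoid ?E\<^esub> f \<in> Scalar (bs_sub G)" if f: "f \<in> Scalar (bs_sub G)" for f
    proof -
      obtain z where z: "f = (\<lambda>x\<in>G. \<lambda>i. z * x i)" using f by (auto simp: Scalar)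
      have "inv\<^bsub>add_monoid ?E\<^esub> f = (\<lambda>x\<in>G. \<lambda>i. (- z) * x i)"
        using a_inv_End_bs_sub[OF G(1) scal[of z]] unfolding z by (simp cong: restrict_cong)
      then show ?thesis unfolding Scalar by blast
    qed
    show "f \<otimes>\<^bsub>add_monoid ?E\<^esub> g \<in> Scalar (bs_sub G)"
      if fg: "f \<in> Scalar (bs_sub G)" "g \<in> Scalar (bs_sub G)" for f g
    proof -
      obtain z where z: "f = (\<lambda>x\<in>G. \<lambda>i. z * x i)" using fg by (auto simp: Scalar)
      obtain w where w: "g = (\<lambda>x\<in>G. \<lambda>i. w * x i)" using fg by (auto simp: Scalar)
      have "f \<oplus>\<^bsub>?E\<^esub> g = (\<lambda>x\<in>G. \<lambda>i. (z + w) * x i)"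
        unfolding add z w by (simp add: distrib_right cong: restrict_cong)
      then show ?thesis unfolding Scalar by auto
    qed
  qed
  moreover have "subgroup (Fin (bs_sub G)) (add_monoid ?E)"
  proof (rule group.subgroupI[OF a_group])
    show "Fin (bs_sub G) \<subseteq> carrier (add_monoid ?E)" by (auto simp: Fin)
    have "finite_rank_on G \<zero>\<^bsub>?E\<^esub>"
      unfolding finite_rank_on_def using zero_in_int_span[of "{}"]
      by (intro exI[of _ "{}"]) (auto simp: zero intro: exI[of _ 1])
    then show "Fin (bs_sub G) \<noteq> {}" using zero_closed by (auto simp: Fin)
    show "inv\<^bsub>add_monoid ?E\<^esub> f \<in> Fin (bs_sub G)" if "f \<in> Fin (bs_sub G)" for f
    proof -
      have f: "f \<in> carrier ?E" "finite_rank_on G f" using that by (auto simp: Fin)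
      have "inv\<^bsub>add_monoid ?E\<^esub> f \<in> carrier ?E"
        using group.inv_closed[OF a_group, of f] f(1) by simp
      moreover have "finite_rank_on G (inv\<^bsub>add_monoid ?E\<^esub> f)"
        unfolding a_inv_End_bs_sub[OF G(1) f(1)]
        using finite_rank_on_lincomb[OF f(2,2), of "-1" 0] by (subst frank) auto
      ultimately show ?thesis by (simp add: Fin)
    qed
    show "f \<otimes>\<^bsub>add_monoid ?E\<^esub> g \<in> Fin (bs_sub G)"
      if "f \<in> Fin (bs_sub G)" "g \<in> Fin (bs_sub G)" for f g
    proof -
      have f: "f \<in> carrier ?E" "finite_rank_on G f" and g: "g \<in> carrier ?E" "finite_rank_on G g"
        using that by (auto simp: Fin)
      have "finite_rank_on G (f \<oplus>\<^bsub>?E\<^esub> g)"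
        using finite_rank_on_lincomb[OF f(2) g(2), of 1 1] by (subst frank) (auto simp: add)
      then show ?thesis using a_closed[OF f(1) g(1)] by (simp add: Fin)
    qed
  qed
  moreover have "carrier ?E = Scalar (bs_sub G) <+>\<^bsub>?E\<^esub> Fin (bs_sub G)"
  proof (intro equalityI subsetI)
    fix f assume f: "f \<in> carrier ?E"
    then obtain z where z: "finite_rank_on G (\<lambda>x i. f x i - z * x i)"
      using almost[of f] by (auto simp: End_def)
    let ?s = "\<lambda>x\<in>G. \<lambda>i. z * x i"
    define g where "g = f \<ominus>\<^bsub>?E\<^esub> ?s"
    have g: "g \<in> carrier ?E" unfolding g_def using f scal by simp
    have g_eq: "g = (\<lambda>x\<in>G. \<lambda>i. f x i - z * x i)"
      using a_inv_End_bs_sub[OF G(1) scal[of z]]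
      by (simp add: g_def a_minus_def a_inv_def add cong: restrict_cong)
    have "finite_rank_on G g" using z unfolding g_eq by (subst frank) auto
    then have "g \<in> Fin (bs_sub G)" using g by (simp add: Fin)
    moreover have "f = ?s \<oplus>\<^bsub>?E\<^esub> g"
    proof
      fix x
      \<comment> \<open>Equality in \<open>End\<close> must also be checked outside G, where both
        sides are \<open>undefined\<close>.\<close>
      have "f \<in> extensional G" using f by (simp add: End_def)
      then have "x \<notin> G \<Longrightarrow> f x = undefined" by (rule extensional_arb)
      then have "f x = (\<lambda>x\<in>G. \<lambda>i. ?s x i + g x i) x"
        by (cases "x \<in> G") (simp_all add: g_eq)
      then show "f x = (?s \<oplus>\<^bsub>?E\<^esub> g) x" by (simp only: add)
    qed
    moreover have "?s \<in> Scalar (bs_sub G)" unfolding Scalar by blast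
    ultimately show "f \<in> Scalar (bs_sub G) <+>\<^bsub>?E\<^esub> Fin (bs_sub G)"
      unfolding set_add_def' by blast
  next
    fix f assume "f \<in> Scalar (bs_sub G) <+>\<^bsub>?E\<^esub> Fin (bs_sub G)"
    then show "f \<in> carrier ?E"
      unfolding set_add_def' using scal a_closed unfolding Scalar Fin by blast
  qed
  moreover have "Scalar (bs_sub G) \<inter> Fin (bs_sub G) = {\<zero>\<^bsub>?E\<^esub>}"
  proof (intro equalityI subsetI)
    fix f assume "f \<in> Scalar (bs_sub G) \<inter> Fin (bs_sub G)"
    then obtain z where z: "f = (\<lambda>x\<in>G. \<lambda>i. z * x i)" "finite_rank_on G f"
      by (auto simp: Scalar Fin)
    then have "finite_rank_on G (\<lambda>x i. z * x i)"
      using frank[of f "\<lambda>x i. z * x i"] by simp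
    then have "z = 0" by (rule scalar_not_finite_rank_on[OF G(2)])
    then show "f \<in> {\<zero>\<^bsub>?E\<^esub>}" using z(1) by (simp add: zero)
  next
    fix f assume "f \<in> {\<zero>\<^bsub>?E\<^esub>}"
    then show "f \<in> Scalar (bs_sub G) \<inter> Fin (bs_sub G)"
      using calculation(1,2) by (auto dest: subgroup.one_closed)
  qed
  ultimately show ?thesis unfolding internal_direct_sum_def by blast
qed

text \<open>Each b in A acts on the group by its integer value; evaluating at unit sequences
  recovers b, so distinct sequences give distinct homomorphisms.\<close>

lemma uncountable_dual_group:
  assumes "uncountable A"
  shows "uncountable (carrier (dual_group (bs_sub (integral_subgroup A))))"
proof -
  let ?G = "integral_subgroup A"
  define ev where "ev b = (\<lambda>x\<in>?G. THE z. dot_lim b x z)" for b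
  have ev: "ev b x = z" if "x \<in> ?G" "dot_lim b x z" for b x z
  proof -
    have "(THE z. dot_lim b x z) = z" using that(2) by (rule the_equality) (rule dot_lim_unique[OF _ that(2)])
    then show ?thesis using that(1) by (simp add: ev_def)
  qed
  have "ev b \<in> carrier (dual_group (bs_sub ?G))" if b: "b \<in> A" for b
  proof -
    have "ev b (\<lambda>i. x i + y i) = ev b x + ev b y" if xy: "x \<in> ?G" "y \<in> ?G" for x y
    proof -
      obtain z where z: "dot_lim b x z" using xy(1) b by (auto simp: integral_subgroup_def)
      obtain w where w: "dot_lim b y w" using xy(2) b by (auto simp: integral_subgroup_def)
      show ?thesis
        using ev[OF xy(1) z] ev[OF xy(2) w]
          ev[OF integral_subgroup_lincomb[OF xy, of 1 1] dot_lim_lincomb_right[OF z w, of 1 1]] by simp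
    qed
    then show ?thesis by (auto simp: dual_group_def hom_def integer_group_def ev_def)
  qed
  moreover have "inj_on ev A"
  proof (rule inj_onI)
    fix b c assume "ev b = ev c"
    moreover have "ev b (unit_seq i) = b i" for b i
    proof (rule ev)
      show "unit_seq i \<in> ?G" using bs_S_subset_integral_subgroup unit_seq_in_bs_S by blast
      show "dot_lim b (unit_seq i) (b i)" using dot_lim_bs_S[of "unit_seq i" b] by simp
    qed
    ultimately show "b = c" by (metis ext)
  qed
  ultimately show ?thesis
    using assms by (metis countable_image_inj_on countable_subset image_subsetI)
qed

theorem mainTheorem1:
  assumes "continuum_hypothesis"
  shows "\<exists>G. subgroup G bs_P \<and>
    bs_S \<subseteq> G \<and> G \<subseteq> bs_D \<and>
    pure_subgroup G (bs_P\<lparr>carrier := bs_D\<rparr>) \<and> pure_subgroup G bs_P \<and>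
    internal_direct_sum (End (bs_P\<lparr>carrier := G\<rparr>)) (Scalar (bs_P\<lparr>carrier := G\<rparr>)) (Fin (bs_P\<lparr>carrier := G\<rparr>)) \<and>
    uncountable (carrier (dual_group (bs_P\<lparr>carrier := G\<rparr>)))"
proof -
  obtain x :: "(nat \<Rightarrow> nat \<Rightarrow> int) \<Rightarrow> nat \<Rightarrow> int" and a where "inj a" and x: "\<And>\<Phi>. x \<Phi> \<in> bs_D"
    and integral: "\<And>\<Phi> \<Psi>. integral_at (a \<Phi>) (x \<Psi>)"
    and kill: "\<And>\<Phi> y. \<not> almost_scalar_mod (range a \<union> range unit_seq) \<Phi> \<Longrightarrow> y \<in> bs_D \<Longrightarrow>
      (\<forall>k. dot_lim (\<Phi> k) (x \<Phi>) (y k)) \<Longrightarrow> \<not> integral_at (a \<Phi>) y"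
    using exists_orthogonal_family[OF assms] by metis
  \<comment> \<open>Coordinate functionals are integral everywhere, so adding them does not shrink
    G; they may occur in the exceptional case.\<close>
  define A where "A = range a \<union> range unit_seq"
  define G where "G = integral_subgroup A"
  have sub: "subgroup G bs_P" unfolding G_def by (rule subgroup_integral_subgroup)
  have GD: "G \<subseteq> bs_D" by (auto simp: G_def integral_subgroup_def)
  have SG: "bs_S \<subseteq> G" unfolding G_def by (rule bs_S_subset_integral_subgroup)
  have xG: "x \<Phi> \<in> G" for \<Phi>
    using x integral dot_lim_unit_left unfolding G_def A_def integral_subgroup_def by blast
  have "\<exists>z. finite_rank_on G (\<lambda>x i. f x i - z * x i)" if f: "f \<in> hom (bs_sub G) (bs_sub G)" for f
  proof -
    \<comment> \<open>Diagonal step: f itself was listed as \<open>\<Phi>\<close>. Since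
      \<open>f (x \<Phi>)\<close> is in G, \<open>a \<Phi>\<close> is integral there, so stage
      \<open>\<Phi>\<close> must have been exceptional.\<close>
    define \<Phi> where "\<Phi> = (\<lambda>k i. f (unit_seq i) k)"
    have y: "f (x \<Phi>) \<in> G" using f xG by (auto simp: hom_def)
    have "integral_at (a \<Phi>) (f (x \<Phi>))"
      using y by (auto simp: G_def A_def integral_subgroup_def)
    moreover have "\<forall>k. dot_lim (\<Phi> k) (x \<Phi>) (f (x \<Phi>) k)"
      unfolding \<Phi>_def using hom_bs_sub_dot_lim f xG unfolding G_def \<Phi>_def by blast
    ultimately have "almost_scalar_mod A \<Phi>"
      using kill[of \<Phi> "f (x \<Phi>)"] y GD unfolding A_def by blast
    then show ?thesis
      using almost_scalar_mod_imp_almost_scalar[of f A] f unfolding G_def \<Phi>_def by blast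
  qed
  then have "internal_direct_sum (End (bs_sub G)) (Scalar (bs_sub G)) (Fin (bs_sub G))"
    by (rule internal_direct_sum_Scalar_Fin[OF sub SG])
  moreover have "uncountable A"
  proof
    assume "countable A"
    then have "countable (range a)" unfolding A_def by (rule countable_subset[rotated]) simp
    then have "countable (UNIV :: (nat \<Rightarrow> nat \<Rightarrow> int) set)"
      using \<open>inj a\<close> by (rule countable_image_inj_on)
    then show False using uncountable_fun_UNIV by blast
  qed
  then have "uncountable (carrier (dual_group (bs_sub G)))"
    unfolding G_def by (rule uncountable_dual_group)
  moreover have "pure_subgroup G (bs_sub bs_D)"
    using pure_integral_subgroup[OF subgroup_bs_D] GD unfolding G_def by blast
  moreover have "pure_subgroup G (bs_sub UNIV)"
    using pure_integral_subgroup[OF bs_P.subgroup_self] unfolding G_def by simp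
  moreover have "bs_sub UNIV = bs_P" by (simp flip: bs_P_simps(1))
  ultimately show ?thesis using sub SG GD by metis
qed

end
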